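(* Let $A\in\mathbb{R}^{n\times n}$ and $k\in\{1,\ldots,n\}$. If $s_k(A)=+\infty$, then $\gamma_k(A,T)=0$ for every $T>0$. Otherwise, writing $s=s_k(A)$, there exist $T_0>0$ and $0<c_\star\leq C_\star$ such that $$c_\star T^{2s-1}\leq\gamma_k(A,T)\leq C_\star T^{2s-1}\qquad\forall T\in(0,T_0].$$ Moreover, there exists a constant $c_k(A)>0$ such that $$\gamma_k(A,T)\sim c_k(A)\,T^{2s-1}\qquad\text{as }T\to0^+.$$ Consequently, $\dfrac{\gamma_k(A,T)}{\gamma_{\mathrm{rel}}(A,T)}\sim n\,c_k(A)\,T^{2s-2}$ as $T\to0^+$. If $A$ is cyclic, then $s_k(A)=\lceil n/k\rceil$.
   Context: For $A\in\mathbb{R}^{n\times n}$, $T>0$ and a real symmetric $n\times n$ matrix $X$, set $\mathcal{G}_T(X)=\int_0^Te^{tA}Xe^{tA^\top}\,dt$. For $k\in\{1,\ldots,n\}$, $$\gamma_k(A,T)=\max_{X\succeq0,\ \operatorname{tr}X=1,\ \operatorname{rank}X\leq k}\lambda_{\min}(\mathcal{G}_T(X)),\qquad \gamma_{\mathrm{rel}}(A,T)=\gamma_n(A,T).$$ For $X\succeq0$ set $\mathcal{K}_j(A,X)=\sum_{q=0}^{j-1}A^q\operatorname{Ran}X$ for $j\geq1$, and $$s_k(A)=\min\{j\geq1\mid\exists X\succeq0,\ \operatorname{tr}X=1,\ \operatorname{rank}X\leq k,\ \mathcal{K}_j(A,X)=\mathbb{R}^n\},$$ with $s_k(A)=+\infty$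 when no such $j$ exists. $A$ is cyclic if $\operatorname{span}(b,Ab,\ldots,A^{n-1}b)=\mathbb{R}^n$ for some $b\in\mathbb{R}^n$. The notation $f(T)\sim g(T)$ means $f(T)/g(T)\to1$. *)

theory Defs
  imports "HOL-Analysis.Analysis" "HOL-Library.Set_Algebras" "HOL-Library.Extended_Nat"
begin

text \<open>The inherited operators \<open>*\<close> and \<open>^\<close> on \<^typ>\<open>real^'n^'n\<close> act entrywise, so
  powers with respect to the matrix product \<open>**\<close> have to be defined separately.\<close>

primrec matrix_power :: "real^'n^'n \<Rightarrow> nat \<Rightarrow> real^'n^'n" where
  "matrix_power A 0 = mat 1"
| "matrix_power A (Suc q) = A ** matrix_power A q"

definition matrix_exp :: "real^'n^'n \<Rightarrow> real^'n^'n" where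
  "matrix_exp A = (\<Sum>q. (1 / fact q) *\<^sub>R matrix_power A q)"

definition psd :: "real^'n^'n \<Rightarrow> bool" where
  "psd X \<longleftrightarrow> transpose X = X \<and> (\<forall>v. 0 \<le> v \<bullet> (X *v v))"

definition eigenvalues :: "real^'n^'n \<Rightarrow> real set" where
  "eigenvalues M = {l. \<exists>v. v \<noteq> 0 \<and> M *v v = l *\<^sub>R v}"

text \<open>Meaningful for symmetric matrices, whose set of real eigenvalues is finite and nonempty.\<close>

definition lambda_min :: "real^'n^'n \<Rightarrow> real" where
  "lambda_min M = Min (eigenvalues M)"

definition gramian :: "real^'n^'n \<Rightarrow> real \<Rightarrow> real^'n^'n \<Rightarrow> real^'n^'n" where
  "gramian A T X =
     integral {0..T} (\<lambda>t. matrix_exp (t *\<^sub>R A) ** X ** matrix_exp (t *\<^sub>R transpose A))"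

definition admissible :: "nat \<Rightarrow> (real^'n^'n) set" where
  "admissible k = {X. psd X \<and> trace X = 1 \<and> rank X \<le> k}"

text \<open>\<open>GREATEST\<close> denotes an attained maximum, not merely a supremum; \<^const>\<open>Max\<close> does not
  apply because \<^term>\<open>admissible k\<close> is infinite in general.\<close>

definition gamma_k :: "nat \<Rightarrow> real^'n^'n \<Rightarrow> real \<Rightarrow> real" where
  "gamma_k k A T = (GREATEST m. m \<in> (\<lambda>X. lambda_min (gramian A T X)) ` admissible k)"

definition gamma_rel :: "real^'n^'n \<Rightarrow> real \<Rightarrow> real" where
  "gamma_rel A T = gamma_k CARD('n) A T"

text \<open>The sum is the pointwise (Minkowski) sum of sets of vectors from
  \<^theory>\<open>HOL-Library.Set_Algebras\<close>.\<close>

definition krylov :: "nat \<Rightarrow> real^'n^'n \<Rightarrow> real^'n^'n \<Rightarrow> (real^'n) set" where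
  "krylov j A X = (\<Sum>q<j. (\<lambda>v. matrix_power A q *v v) ` range (\<lambda>v. X *v v))"

text \<open>The infimum in \<^typ>\<open>enat\<close> is the least element of a nonempty set, and \<open>\<infinity>\<close> for the
  empty set.\<close>

definition s_k :: "nat \<Rightarrow> real^'n^'n \<Rightarrow> enat" where
  "s_k k A = Inf {enat j | j. 1 \<le> j \<and> (\<exists>X \<in> admissible k. krylov j A X = UNIV)}"

definition cyclic :: "real^'n^'n \<Rightarrow> bool" where
  "cyclic A \<longleftrightarrow> (\<exists>b. span ((\<lambda>q. matrix_power A q *v b) ` {..<CARD('n)}) = UNIV)"

end

theory Submission
  imports Defs
begin

text \<open>Write \<open>M = A\<^sup>T\<close>, \<open>d = s - 1\<close>, and let \<open>\<kappa>\<close> be the infimum of \<open>\<integral>\<^sub>0\<^sup>1 p\<^sup>2\<close> over monic polynomials of degree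
  \<open>d\<close>. By minimality of \<open>s\<close>, for every admissible \<open>X\<close> there are unit vectors \<open>v\<close> with \<open>X M\<^sup>q v = 0\<close> for
  all \<open>q < d\<close>; on them the Gramian form starts with \<open>t\<^bsup>2d\<^esup> \<langle>M\<^sup>d v, X M\<^sup>d v\<rangle> / (d!)\<^sup>2\<close>. Perturbing \<open>v\<close> by
  small multiples of \<open>M v, \<dots>, M\<^sup>d v\<close> replaces \<open>t\<^sup>d\<close> by any monic polynomial, which bounds
  \<open>\<lambda>\<^sub>m\<^sub>i\<^sub>n\<close> by \<open>T\<^bsup>2d+1\<^esup> (\<kappa> \<langle>M\<^sup>d v, X M\<^sup>d v\<rangle> / (d!)\<^sup>2 + o(1))\<close> uniformly in \<open>X\<close>. For a fixed \<open>X\<close>, a compactness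
  argument shows that minimising vectors accumulate at such \<open>v\<close>, and that no other perturbation does
  better. Hence \<open>c\<^sub>k(A)\<close> is \<open>\<kappa> / (d!)\<^sup>2\<close> times the supremum over \<open>X\<close> of the minimum over \<open>v\<close> of
  \<open>\<langle>M\<^sup>d v, X M\<^sup>d v\<rangle>\<close>; uniformity of the upper bound in \<open>X\<close> makes the limit commute with the maximum.\<close>

section \<open>Positive semidefinite forms and the least eigenvalue\<close>

text \<open>As a simp rule it turns \<open>transpose A *v v\<close> into \<open>v v* A\<close>,
  whereas every adjoint below is kept in the form \<open>transpose A *v v\<close>.\<close>

declare transpose_matrix_vector [simp del]

lemma inner_matrix_left: "(A *v x) \<bullet> y = x \<bullet> (transpose A *v (y::real^'n))" for A :: "real^'m^'n"
  by (metis dot_lmul_matrix inner_commute transpose_matrix_vector)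

lemma inner_matrix_right: "x \<bullet> (A *v y) = (transpose A *v x) \<bullet> (y::real^'m)" for A :: "real^'m^'n"
  by (metis dot_lmul_matrix transpose_matrix_vector)

lemma symmetric_inner: "transpose X = X \<Longrightarrow> (X *v x) \<bullet> y = x \<bullet> (X *v (y::real^'n))"
  by (simp add: inner_matrix_left)

lemma symmetric_inner_commute: "transpose X = X \<Longrightarrow> x \<bullet> (X *v y) = y \<bullet> (X *v (x::real^'n))"
  by (metis inner_commute symmetric_inner)

lemma quadratic_form_add:
  fixes x y :: "real^'n"
  assumes "transpose X = X"
  shows "(x + y) \<bullet> (X *v (x + y)) = x \<bullet> (X *v x) + 2 * (x \<bullet> (X *v y)) + y \<bullet> (X *v y)"
  using symmetric_inner_commute[OF assms, of y x]
  by (simp add: matrix_vector_right_distrib inner_add_left inner_add_right)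

text \<open>The quadratic \<open>a + 2 * r * b + r^2 * c\<close> in \<open>r\<close> is the form at
  \<open>x + r y\<close>, hence nonnegative; its value at the minimiser \<open>r = - b / c\<close>
  gives the claim. For \<open>c = 0\<close> it is affine and stays nonnegative only if
  \<open>b = 0\<close>.\<close>

lemma psd_Cauchy_Schwarz:
  fixes x y :: "real^'n"
  assumes "psd X"
  shows "(x \<bullet> (X *v y))\<^sup>2 \<le> (x \<bullet> (X *v x)) * (y \<bullet> (X *v y))"
proof -
  have sym: "transpose X = X" and nn: "\<And>v. 0 \<le> v \<bullet> (X *v v)"
    using assms by (auto simp: psd_def)
  define a b c where "a = x \<bullet> (X *v x)" and "b = x \<bullet> (X *v y)" and "c = y \<bullet> (X *v y)"
  have q: "0 \<le> a + 2 * r * b + r\<^sup>2 * c" for r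
    using nn[of "x + r *\<^sub>R y"] quadratic_form_add[OF sym, of x "r *\<^sub>R y"]
    by (simp add: a_def b_def c_def matrix_vector_mult_scaleR power2_eq_square mult.assoc)
  have "0 \<le> a" "0 \<le> c" using nn by (auto simp: a_def c_def)
  show ?thesis
  proof (cases "c = 0")
    case True
    have "b = 0"
    proof (rule ccontr)
      assume "b \<noteq> 0"
      \<comment> \<open>This \<open>r\<close> would make the affine function equal to
        \<open>-1\<close>.\<close>
      then show False using q[of "- (a + 1) / (2 * b)"] True by (simp add: field_simps)
    qed
    then show ?thesis using \<open>0 \<le> a\<close> True by (simp add: a_def b_def c_def)
  next
    case False
    with \<open>0 \<le> c\<close> have "0 < c" by simp
    then have "b\<^sup>2 \<le> a * c" using q[of "- b / c"] by (simp add: field_simps power2_eq_square)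
    then show ?thesis by (simp add: a_def b_def c_def)
  qed
qed

text \<open>Cauchy-Schwarz against the vector \<open>X *v v\<close> itself bounds the fourth power
  of its norm by zero.\<close>

lemma psd_kernel:
  fixes v :: "real^'n"
  assumes "psd X" "v \<bullet> (X *v v) = 0"
  shows "X *v v = 0"
  using psd_Cauchy_Schwarz[OF assms(1), of "X *v v" v] assms(2) by simp

text \<open>The norm on nested vectors is the Frobenius norm, so Cauchy-Schwarz is applied to each
  row and the squares are summed.\<close>

lemma norm_matrix_vector_le: "norm (X *v v) \<le> norm X * norm (v::real^'n)" for X :: "real^'n^'m"
proof -
  have "(norm (X *v v))\<^sup>2 = (\<Sum>i\<in>UNIV. (X $ i \<bullet> v)\<^sup>2)"
    by (simp add: norm_vec_def L2_set_def sum_nonneg matrix_mult_dot)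
  also have "\<dots> \<le> (\<Sum>i\<in>UNIV. (norm (X $ i) * norm v)\<^sup>2)"
  proof (rule sum_mono)
    show "(X $ i \<bullet> v)\<^sup>2 \<le> (norm (X $ i) * norm v)\<^sup>2" for i
      using Cauchy_Schwarz_ineq2[of "X $ i" v] by (metis abs_le_square_iff abs_mult abs_norm_cancel)
  qed
  also have "\<dots> = (norm X * norm v)\<^sup>2"
    by (simp add: norm_vec_def[of X] L2_set_def sum_nonneg power_mult_distrib sum_distrib_right)
  finally show ?thesis
    by (metis abs_le_square_iff abs_mult abs_norm_cancel)
qed

lemma inner_matrix_le: "\<bar>x \<bullet> (X *v y)\<bar> \<le> norm X * norm x * norm (y::real^'n)" for X :: "real^'n^'m"
proof -
  have "\<bar>x \<bullet> (X *v y)\<bar> \<le> norm x * norm (X *v y)" by (rule Cauchy_Schwarz_ineq2)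
  also have "\<dots> \<le> norm x * (norm X * norm y)"
    by (intro mult_left_mono norm_matrix_vector_le) auto
  finally show ?thesis by (simp add: mult_ac)
qed

text \<open>Diagonal entries are nonnegative with sum 1, and Cauchy-Schwarz on basis vectors carries
  the bound 1 to all entries. This crude estimate gives compactness of the admissible set and
  constants uniform in \<open>X\<close>.\<close>

lemma psd_norm_le:
  fixes X :: "real^'n^'n"
  assumes "psd X" "trace X = 1"
  shows "norm X \<le> (real CARD('n))\<^sup>2"
proof -
  have e: "axis i 1 \<bullet> (X *v axis j 1) = X $ i $ j" for i j
    by (simp add: inner_axis' matrix_vector_mult_basis column_def)
  have nn: "0 \<le> X $ i $ i" for i
    using assms(1) e[of i i] by (metis psd_def)
  have "X $ i $ i \<le> trace X" for i
    unfolding trace_def using nn by (intro member_le_sum) auto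
  then have le: "X $ i $ i \<le> 1" for i by (simp add: assms(2))
  have "(X $ i $ j)\<^sup>2 \<le> 1" for i j
    using psd_Cauchy_Schwarz[OF assms(1), of "axis i 1" "axis j 1"] mult_mono[OF le le] nn
    unfolding e by (smt (verit, best) mult_cancel_right2)
  then have ent: "\<bar>X $ i $ j\<bar> \<le> 1" for i j
    by (simp add: abs_square_le_1)
  have "norm (X $ i) \<le> real CARD('n)" for i
    using norm_le_l1_cart[of "X $ i"] sum_bounded_above[of UNIV "\<lambda>j. \<bar>X $ i $ j\<bar>" 1] ent by auto
  then have "(\<Sum>i\<in>UNIV. norm (X $ i)) \<le> real CARD('n) * real CARD('n)"
    using sum_bounded_above[of UNIV "\<lambda>i. norm (X $ i)" "real CARD('n)"] by auto
  moreover have "norm X \<le> (\<Sum>i\<in>UNIV. norm (X $ i))"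
    unfolding norm_vec_def by (rule L2_set_le_sum) auto
  ultimately show ?thesis by (simp add: power2_eq_square)
qed

text \<open>One eigenvector per eigenvalue gives a pairwise orthogonal family, which is finite.
  Finiteness is what gives \<open>Min\<close> in \<open>lambda_min\<close> its meaning.\<close>

lemma symmetric_eigenvalues_finite:
  fixes M :: "real^'n^'n"
  assumes sym: "transpose M = M"
  shows "finite (eigenvalues M)"
proof -
  define f where "f l = (SOME v. v \<noteq> 0 \<and> M *v v = l *\<^sub>R v)" for l
  have f: "f l \<noteq> 0 \<and> M *v f l = l *\<^sub>R f l" if "l \<in> eigenvalues M" for l
    unfolding f_def by (rule someI_ex) (use that in \<open>auto simp: eigenvalues_def\<close>)
  have orth: "f l \<bullet> f m = 0" if "l \<in> eigenvalues M" "m \<in> eigenvalues M" "l \<noteq> m" for l m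
    using symmetric_inner[OF sym, of "f l" "f m"] f[OF that(1)] f[OF that(2)] that(3) by auto
  have "inj_on f (eigenvalues M)"
    by (rule inj_onI) (metis f orth inner_eq_zero_iff)
  moreover have "pairwise orthogonal (f ` eigenvalues M)"
    using orth by (auto simp: pairwise_def orthogonal_def)
  ultimately show ?thesis
    using pairwise_orthogonal_imp_finite finite_image_iff by blast
qed

text \<open>Let \<open>l\<close> be the minimum of the form on the unit sphere, attained at
  \<open>v\<close>. Then \<open>M - l I\<close> is positive semidefinite and its form vanishes at
  \<open>v\<close>, so \<open>psd_kernel\<close> makes \<open>v\<close> an eigenvector; every other
  eigenvalue is a value of the form and is at least \<open>l\<close>.\<close>

lemma lambda_min_Rayleigh:
  fixes M :: "real^'n^'n"
  assumes sym: "transpose M = M"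
  shows "\<exists>v. norm v = 1 \<and> v \<bullet> (M *v v) = lambda_min M"
    and "lambda_min M * (norm w)\<^sup>2 \<le> w \<bullet> (M *v w)"
proof -
  have "continuous_on (sphere 0 1) (\<lambda>v. v \<bullet> (M *v v))"
    by (intro continuous_intros linear_continuous_on) auto
  moreover have "sphere (0::real^'n) 1 \<noteq> {}"
    by (metis mem_sphere_0 norm_axis_1 empty_iff)
  ultimately obtain v where v: "norm v = 1"
    and min: "\<And>u. norm u = 1 \<Longrightarrow> v \<bullet> (M *v v) \<le> u \<bullet> (M *v u)"
    using continuous_attains_inf[of "sphere 0 1" "\<lambda>v. v \<bullet> (M *v v)"] by auto
  define l where "l = v \<bullet> (M *v v)"
  have ge: "l * (norm w)\<^sup>2 \<le> w \<bullet> (M *v w)" for w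
  proof (cases "w = 0")
    case False
    have "l \<le> (w /\<^sub>R norm w) \<bullet> (M *v (w /\<^sub>R norm w))"
      unfolding l_def using False by (intro min) simp
    also have "\<dots> = (w \<bullet> (M *v w)) / (norm w)\<^sup>2"
      by (simp add: matrix_vector_mult_scaleR power2_eq_square divide_inverse mult_ac)
    finally show ?thesis using False by (simp add: field_simps)
  qed simp
  define X where "X = M - l *\<^sub>R mat 1"
  have X: "X *v w = M *v w - l *\<^sub>R w" for w
    by (simp add: X_def matrix_vector_mult_diff_rdistrib flip: scaleR_matrix_vector_assoc)
  have "transpose X = X"
    using sym unfolding X_def by (simp add: vec_eq_iff transpose_def mat_def)
  then have "psd X"
    using ge by (simp add: psd_def X inner_diff_right power2_norm_eq_inner)
  moreover have "v \<bullet> (X *v v) = 0"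
    using v by (simp add: X inner_diff_right l_def power2_norm_eq_inner[symmetric])
  ultimately have ev: "M *v v = l *\<^sub>R v"
    using psd_kernel[of X v] X[of v] by simp
  have "lambda_min M = l"
    unfolding lambda_min_def
  proof (rule Min_eqI)
    show "finite (eigenvalues M)" by (rule symmetric_eigenvalues_finite[OF sym])
    show "l \<in> eigenvalues M" unfolding eigenvalues_def using ev v by (auto intro!: exI[of _ v])
    fix m assume "m \<in> eigenvalues M"
    then obtain u where "u \<noteq> 0" "M *v u = m *\<^sub>R u" by (auto simp: eigenvalues_def)
    then show "l \<le> m" using ge[of u] by (simp add: power2_norm_eq_inner)
  qed
  then show "\<exists>v. norm v = 1 \<and> v \<bullet> (M *v v) = lambda_min M"
    and "lambda_min M * (norm w)\<^sup>2 \<le> w \<bullet> (M *v w)"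
    using v ge by (auto simp: l_def)
qed

text \<open>The unit vector minimising one form is a test vector for the other. This supplies the
  continuity behind the attained maximum in \<open>gamma_k\<close>.\<close>

lemma lambda_min_Lipschitz:
  fixes M N :: "real^'n^'n"
  assumes "transpose M = M" "transpose N = N"
  shows "\<bar>lambda_min M - lambda_min N\<bar> \<le> norm (M - N)"
proof -
  have *: "lambda_min M - lambda_min N \<le> norm (M - N)"
    if sym: "transpose M = M" "transpose N = N" for M N :: "real^'n^'n"
  proof -
    obtain v where v: "norm v = 1" "v \<bullet> (N *v v) = lambda_min N"
      using lambda_min_Rayleigh(1)[OF sym(2)] by blast
    have "lambda_min M \<le> v \<bullet> (M *v v)"
      using lambda_min_Rayleigh(2)[OF sym(1), of v] v(1) by simp
    also have "\<dots> = v \<bullet> (N *v v) + v \<bullet> ((M - N) *v v)"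
      by (simp add: matrix_vector_mult_diff_rdistrib inner_diff_right)
    also have "\<dots> \<le> lambda_min N + norm (M - N)"
      using inner_matrix_le[of v "M - N" v] v by simp
    finally show ?thesis by simp
  qed
  show ?thesis using *[OF assms] *[OF assms(2,1)] by (simp add: norm_minus_commute abs_le_iff)
qed

text \<open>Lower semicontinuity of the rank: \<open>X\<close> is bounded below on the orthogonal
  complement \<open>W\<close> of its kernel, whose dimension is at least \<open>rank X\<close>. A
  matrix close enough to \<open>X\<close> stays injective on \<open>W\<close>.\<close>

lemma rank_le_closed: "closed {X :: real^'n^'m. rank X \<le> k}"
proof -
  have "open {X :: real^'n^'m. k < rank X}"
    unfolding open_dist
  proof safe
    fix X :: "real^'n^'m" assume k: "k < rank X"
    define W where "W = {y. \<forall>x\<in>{x. X *v x = 0}. orthogonal x y}"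
    have ker: "subspace {x. X *v x = 0}"
      by (simp add: subspace_def matrix_vector_right_distrib matrix_vector_mult_scaleR)
    have W: "subspace W"
      unfolding W_def by (rule subspace_orthogonal_to_vectors)
    have inj: "x = 0" if "x \<in> W" "X *v x = 0" for x
      using that by (auto simp: W_def orthogonal_def)
    have "X *v x \<in> (*v) X ` W" for x
    proof -
      obtain y z where "y \<in> span {x. X *v x = 0}"
        and z: "\<And>w. w \<in> span {x. X *v x = 0} \<Longrightarrow> orthogonal z w" and x: "x = y + z"
        using orthogonal_subspace_decomp_exists[of "{x. X *v x = 0}" x] by blast
      then have "X *v y = 0" "z \<in> W"
        using ker by (auto simp: W_def orthogonal_commute span_eq_iff[THEN iffD2])
      then show ?thesis by (auto simp: x matrix_vector_right_distrib)
    qed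
    then have "rank X \<le> dim ((*v) X ` W)"
      unfolding rank_dim_range by (intro dim_subset) auto
    also have "\<dots> \<le> dim W"
      by (intro dim_image_le) auto
    finally have dimW: "rank X \<le> dim W" .
    obtain e where e: "e > 0" "\<And>x. x \<in> W \<Longrightarrow> e * norm x \<le> norm (X *v x)"
      using injective_imp_isometric[of W "(*v) X"] closed_subspace[OF W] W inj by auto
    have "k < rank Y" if "dist Y X < e" for Y
    proof -
      have "x = 0" if x: "x \<in> W" "Y *v x = 0" for x
      proof (rule ccontr)
        assume "x \<noteq> 0"
        have "e * norm x \<le> norm ((X - Y) *v x)"
          using e(2)[OF x(1)] x(2) by (simp add: matrix_vector_mult_diff_rdistrib)
        also have "\<dots> \<le> norm (X - Y) * norm x" by (rule norm_matrix_vector_le)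
        also have "\<dots> < e * norm x"
          using \<open>dist Y X < e\<close> \<open>x \<noteq> 0\<close> by (simp add: dist_norm norm_minus_commute)
        finally show False by simp
      qed
      then have "inj_on ((*v) Y) W"
        using W by (intro inj_onI) (metis eq_iff_diff_eq_0 matrix_vector_mult_diff_distrib subspace_diff)
      then have "dim ((*v) Y ` W) = dim W"
        by (intro dim_image_eq) (use W in \<open>auto simp: span_eq_iff[THEN iffD2]\<close>)
      moreover have "dim ((*v) Y ` W) \<le> rank Y"
        unfolding rank_dim_range by (intro dim_subset) auto
      ultimately show ?thesis using k dimW by simp
    qed
    then show "\<exists>e>0. \<forall>Y. dist Y X < e \<longrightarrow> Y \<in> {X. k < rank X}"
      using e(1) by auto
  qed
  moreover have "{X :: real^'n^'m. rank X \<le> k} = - {X. k < rank X}" by auto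
  ultimately show ?thesis by (simp add: open_closed)
qed

section \<open>The matrix exponential and the Gramian\<close>

lemma norm_transpose: "norm (transpose A) = norm A" for A :: "real^'n^'m"
proof -
  have "(\<Sum>i\<in>UNIV. (norm (transpose A $ i))\<^sup>2) = (\<Sum>i\<in>UNIV. (norm (A $ i))\<^sup>2)"
    by (simp add: norm_vec_def L2_set_def sum_nonneg transpose_def) (rule sum.swap)
  then show ?thesis by (simp add: norm_vec_def[of A] norm_vec_def[of "transpose A"] L2_set_def)
qed

lemma norm_matrix_mult_le: "norm (A ** B) \<le> norm A * norm B" for A :: "real^'n^'m" and B :: "real^'l^'n"
proof -
  have row: "(A ** B) $ i = transpose B *v A $ i" for i
    by (simp add: vec_eq_iff matrix_matrix_mult_def matrix_vector_mult_def transpose_def mult.commute)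
  have "(norm (A ** B))\<^sup>2 = (\<Sum>i\<in>UNIV. (norm ((A ** B) $ i))\<^sup>2)"
    by (simp add: norm_vec_def[of "A ** B"] L2_set_def sum_nonneg)
  also have "\<dots> \<le> (\<Sum>i\<in>UNIV. (norm (A $ i) * norm B)\<^sup>2)"
    unfolding row
    by (intro sum_mono power_mono)
      (metis mult.commute norm_matrix_vector_le norm_transpose, simp)
  also have "\<dots> = (norm A * norm B)\<^sup>2"
    by (simp add: norm_vec_def[of A] L2_set_def sum_nonneg power_mult_distrib sum_distrib_right)
  finally show ?thesis
    by (metis abs_le_square_iff abs_mult abs_norm_cancel)
qed

lemma bounded_bilinear_matrix_mult: "bounded_bilinear ((**) :: real^'n^'m \<Rightarrow> real^'l^'n \<Rightarrow> _)"
proof (rule bounded_bilinear.intro)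
  show "\<exists>K. \<forall>a b. norm ((a::real^'n^'m) ** (b::real^'l^'n)) \<le> norm a * norm b * K"
    using norm_matrix_mult_le by (intro exI[of _ 1]) auto
qed (auto simp: vec_eq_iff matrix_matrix_mult_def sum.distrib algebra_simps scaleR_sum_right sum_distrib_left)

lemma bounded_linear_matrix_vector: "bounded_linear (\<lambda>A :: real^'n^'m. A *v v)"
  using norm_matrix_vector_le
  by (intro bounded_linear_intro[of _ "norm v"])
    (auto simp: matrix_vector_mult_add_rdistrib simp flip: scaleR_matrix_vector_assoc)

lemma bounded_linear_transpose: "bounded_linear (transpose :: real^'n^'m \<Rightarrow> _)"
  by (rule bounded_linear_intro[of _ 1])
    (simp_all add: norm_transpose transpose_scalar, simp add: transpose_def vec_eq_iff)

lemma matrix_power_scaleR: "matrix_power (c *\<^sub>R A) q = c ^ q *\<^sub>R matrix_power A q"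
  by (induction q) (auto simp: bounded_bilinear.scaleR_left[OF bounded_bilinear_matrix_mult]
      bounded_bilinear.scaleR_right[OF bounded_bilinear_matrix_mult])

lemma matrix_power_commute: "matrix_power A q ** A = A ** matrix_power A q"
  by (induction q) (auto simp: matrix_mul_assoc[symmetric])

lemma matrix_power_add: "matrix_power A (p + q) = matrix_power A p ** matrix_power A q"
  by (induction p) (auto simp: matrix_mul_assoc)

lemma transpose_matrix_power: "transpose (matrix_power A q) = matrix_power (transpose A) q"
  by (induction q) (auto simp: matrix_transpose_mul matrix_power_commute)

lemma matrix_power_vector_add:
  "matrix_power A p *v (matrix_power A q *v v) = matrix_power A (p + q) *v v"
  by (simp add: matrix_power_add matrix_vector_mul_assoc)

lemma norm_matrix_power_vector_le: "norm (matrix_power A q *v v) \<le> norm A ^ q * norm v"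
proof (induction q)
  case (Suc q)
  have "norm (A *v (matrix_power A q *v v)) \<le> norm A * norm (matrix_power A q *v v)"
    by (rule norm_matrix_vector_le)
  also have "\<dots> \<le> norm A * (norm A ^ q * norm v)"
    using Suc by (intro mult_left_mono) auto
  finally show ?case by (simp add: matrix_vector_mul_assoc mult_ac)
qed simp

text \<open>The Frobenius norm of the identity is \<open>sqrt n\<close>, whence the extra
  factor.\<close>

lemma norm_matrix_power_le: "norm (matrix_power A q) \<le> norm A ^ q * norm (mat 1 :: real^'n^'n)"
  for A :: "real^'n^'n"
proof (induction q)
  case (Suc q)
  have "norm (A ** matrix_power A q) \<le> norm A * norm (matrix_power A q)"
    by (rule norm_matrix_mult_le)
  also have "\<dots> \<le> norm A * (norm A ^ q * norm (mat 1 :: real^'n^'n))"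
    using Suc by (intro mult_left_mono) auto
  finally show ?case by (simp add: mult_ac)
qed simp

text \<open>One majorant for both the summability of the series and the Weierstrass M-test on
  \<open>{0..T}\<close>.\<close>

lemma matrix_exp_term_norm_le:
  fixes A :: "real^'n^'n"
  assumes "\<bar>t\<bar> \<le> T"
  shows "norm ((1 / fact q) *\<^sub>R matrix_power (t *\<^sub>R A) q)
    \<le> norm (mat 1 :: real^'n^'n) * ((T * norm A) ^ q /\<^sub>R fact q)"
proof -
  have "norm ((1 / fact q) *\<^sub>R matrix_power (t *\<^sub>R A) q) = \<bar>t\<bar> ^ q / fact q * norm (matrix_power A q)"
    by (simp add: matrix_power_scaleR power_abs)
  also have "\<dots> \<le> T ^ q / fact q * (norm A ^ q * norm (mat 1 :: real^'n^'n))"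
    using assms by (intro mult_mono norm_matrix_power_le divide_right_mono power_mono) auto
  finally show ?thesis by (simp add: power_mult_distrib field_simps)
qed

lemma summable_matrix_exp: "summable (\<lambda>q. (1 / fact q) *\<^sub>R matrix_power A q)" for A :: "real^'n^'n"
  using matrix_exp_term_norm_le[of 1 1 _ A]
  by (intro summable_comparison_test'[OF summable_mult[OF summable_exp_generic]]) simp

lemma transpose_matrix_exp: "transpose (matrix_exp A) = matrix_exp (transpose A)" for A :: "real^'n^'n"
  unfolding matrix_exp_def
  by (simp add: bounded_linear.suminf[OF bounded_linear_transpose summable_matrix_exp]
      transpose_scalar transpose_matrix_power)

lemma continuous_on_matrix_exp: "continuous_on {0..T} (\<lambda>t. matrix_exp (t *\<^sub>R A))" for A :: "real^'n^'n"
proof -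
  have "uniform_limit {0..T} (\<lambda>n t. \<Sum>q<n. (1 / fact q) *\<^sub>R matrix_power (t *\<^sub>R A) q)
      (\<lambda>t. \<Sum>q. (1 / fact q) *\<^sub>R matrix_power (t *\<^sub>R A) q) sequentially"
    by (rule Weierstrass_m_test[OF matrix_exp_term_norm_le[where T=T]])
      (simp, rule summable_mult[OF summable_exp_generic])
  then show ?thesis
    unfolding matrix_exp_def
    by (rule uniform_limit_theorem[rotated])
      (auto intro!: always_eventually continuous_intros simp: matrix_power_scaleR)
qed

section \<open>The exponential acting on a vector\<close>

abbreviation flow :: "real^'n^'n \<Rightarrow> real \<Rightarrow> real^'n \<Rightarrow> real^'n" where
  "flow M t v \<equiv> matrix_exp (t *\<^sub>R M) *v v"

lemma flow_sums: "(\<lambda>q. (t ^ q / fact q) *\<^sub>R (matrix_power M q *v v)) sums flow M t v"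
  using bounded_linear.sums[OF bounded_linear_matrix_vector summable_sums[OF summable_matrix_exp[of "t *\<^sub>R M"]], of v]
  by (simp add: matrix_exp_def matrix_power_scaleR flip: scaleR_matrix_vector_assoc)

text \<open>In the tail, \<open>fact (q + j) \<ge> fact q * fact j\<close> lets
  \<open>x^j / fact j\<close> be factored out, leaving the full exponential series. The factorial is
  retained because \<open>lambda_min_gramian_zero\<close> lets \<open>j\<close> tend to
  infinity.\<close>

lemma flow_Taylor:
  "norm (flow M t v - (\<Sum>q<j. (t ^ q / fact q) *\<^sub>R (matrix_power M q *v v)))
    \<le> (\<bar>t\<bar> * norm M) ^ j / fact j * exp (\<bar>t\<bar> * norm M) * norm v"
proof -
  define x where "x = \<bar>t\<bar> * norm M"
  have x: "0 \<le> x" by (simp add: x_def)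
  define f where "f q = (t ^ q / fact q) *\<^sub>R (matrix_power M q *v v)" for q
  define g where "g q = x ^ j / fact j * norm v * (x ^ q /\<^sub>R fact q)" for q
  have g: "g sums (x ^ j / fact j * norm v * exp x)"
    unfolding g_def by (intro sums_mult exp_converges)
  have le: "norm (f (q + j)) \<le> g q" for q
  proof -
    have "norm (f (q + j)) = \<bar>t\<bar> ^ (q + j) / fact (q + j) * norm (matrix_power M (q + j) *v v)"
      by (simp add: f_def power_abs)
    also have "\<dots> \<le> \<bar>t\<bar> ^ (q + j) / fact (q + j) * (norm M ^ (q + j) * norm v)"
      by (intro mult_left_mono norm_matrix_power_vector_le) auto
    also have "\<dots> = x ^ (q + j) * norm v / fact (q + j)"
      by (simp add: x_def power_mult_distrib)
    also have "\<dots> \<le> x ^ (q + j) * norm v / (fact q * fact j)"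
    proof (rule divide_left_mono)
      have "fact q * fact j \<le> (fact (q + j) :: nat)"
        by (intro dvd_imp_le fact_fact_dvd_fact) simp
      then show "fact q * fact j \<le> (fact (q + j) :: real)"
        by (metis of_nat_fact of_nat_le_iff of_nat_mult)
    qed (use x in auto)
    also have "\<dots> = g q" by (simp add: g_def power_add field_simps)
    finally show ?thesis .
  qed
  have f: "f sums flow M t v" unfolding f_def by (rule flow_sums)
  have "flow M t v - (\<Sum>q<j. f q) = (\<Sum>q. f (q + j))"
    using suminf_split_initial_segment[OF sums_summable[OF f], of j] sums_unique[OF f] by simp
  also have "norm \<dots> \<le> (\<Sum>q. g q)"
    by (rule norm_suminf_le[OF le sums_summable[OF g]])
  also have "\<dots> = x ^ j / fact j * norm v * exp x"
    by (rule sums_unique[OF g, symmetric])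
  finally show ?thesis by (simp add: f_def x_def mult_ac)
qed

lemma continuous_on_flow: "continuous_on {0..T} (\<lambda>t. flow M t v)"
  by (rule bounded_linear.continuous_on[OF bounded_linear_matrix_vector continuous_on_matrix_exp])

lemma continuous_on_flow_form: "continuous_on {0..T} (\<lambda>t. flow M t x \<bullet> (X *v flow M t y))"
  by (intro continuous_on_inner continuous_on_flow
      bounded_linear.continuous_on[OF matrix_vector_mul_bounded_linear])

section \<open>The Gramian as a quadratic form, and attainment of the maximum\<close>

lemma integrable_gramian:
  "(\<lambda>t. matrix_exp (t *\<^sub>R A) ** X ** matrix_exp (t *\<^sub>R transpose A)) integrable_on {0..T}"
  for A :: "real^'n^'n"
  by (intro integrable_continuous_real bounded_bilinear.continuous_on[OF bounded_bilinear_matrix_mult]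
      continuous_on_matrix_exp continuous_on_const)

text \<open>The evaluation \<open>N \<mapsto> x \<bullet> (N *v y)\<close> is linear and passes
  under the integral; the left exponential then moves onto \<open>x\<close> as its transpose, so
  only the flow of \<open>transpose A\<close> remains.\<close>

lemma gramian_form:
  fixes A X :: "real^'n^'n"
  shows "x \<bullet> (gramian A T X *v y)
    = integral {0..T} (\<lambda>t. flow (transpose A) t x \<bullet> (X *v flow (transpose A) t y))"
proof -
  have "bounded_linear (\<lambda>N :: real^'n^'n. x \<bullet> (N *v y))"
    using bounded_linear_compose[OF bounded_linear_inner_right bounded_linear_matrix_vector] .
  from integral_linear[OF integrable_gramian this, of T A X, unfolded o_def]
  have "x \<bullet> (gramian A T X *v y) = integral {0..T}
      (\<lambda>t. x \<bullet> ((matrix_exp (t *\<^sub>R A) ** X ** matrix_exp (t *\<^sub>R transpose A)) *v y))"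
    by (simp add: gramian_def)
  also have "(\<lambda>t. x \<bullet> ((matrix_exp (t *\<^sub>R A) ** X ** matrix_exp (t *\<^sub>R transpose A)) *v y))
    = (\<lambda>t. flow (transpose A) t x \<bullet> (X *v flow (transpose A) t y))"
    by (simp add: matrix_vector_mul_assoc[symmetric] inner_matrix_right transpose_matrix_exp
        transpose_scalar)
  finally show ?thesis .
qed

lemma symmetric_gramian:
  assumes "transpose X = X"
  shows "transpose (gramian A T X) = gramian A T X"
proof -
  have "x \<bullet> (transpose (gramian A T X) *v y) = x \<bullet> (gramian A T X *v y)" for x y
  proof -
    have "x \<bullet> (transpose (gramian A T X) *v y) = y \<bullet> (gramian A T X *v x)"
      by (metis inner_commute inner_matrix_left)
    also have "\<dots> = x \<bullet> (gramian A T X *v y)"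
      unfolding gramian_form by (subst symmetric_inner_commute[OF assms]) simp
    finally show ?thesis .
  qed
  then show ?thesis by (metis matrix_eq vector_eq_ldot)
qed

lemma linear_gramian: "linear (gramian A T)" for A :: "real^'n^'n"
proof (rule linearI)
  show "gramian A T (X + Y) = gramian A T X + gramian A T Y" for X Y
    unfolding gramian_def using integral_add[OF integrable_gramian integrable_gramian, of T A X A Y]
    by (simp add: bounded_bilinear.add_left[OF bounded_bilinear_matrix_mult]
      bounded_bilinear.add_right[OF bounded_bilinear_matrix_mult])
  show "gramian A T (c *\<^sub>R X) = c *\<^sub>R gramian A T X" for c X
    unfolding gramian_def
    by (simp add: bounded_bilinear.scaleR_left[OF bounded_bilinear_matrix_mult]
      bounded_bilinear.scaleR_right[OF bounded_bilinear_matrix_mult])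
qed

lemma gramian_form_nonneg: "psd X \<Longrightarrow> 0 \<le> v \<bullet> (gramian A T X *v v)"
  unfolding gramian_form
  by (intro integral_nonneg integrable_continuous_real continuous_on_flow_form) (auto simp: psd_def)

lemma lambda_min_gramian_nonneg:
  assumes "psd X"
  shows "0 \<le> lambda_min (gramian A T X)"
  using lambda_min_Rayleigh(1)[OF symmetric_gramian] gramian_form_nonneg[OF assms] assms
  unfolding psd_def by metis

lemma compact_admissible: "compact (admissible k :: (real^'n^'n) set)"
proof -
  have "bounded (admissible k :: (real^'n^'n) set)"
    using psd_norm_le unfolding bounded_iff admissible_def by blast
  moreover have "closed {X :: real^'n^'n. psd X}"
    unfolding psd_def
    by (intro closed_Collect_conj closed_Collect_all closed_Collect_eq closed_Collect_le continuous_intros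
        linear_continuous_on bounded_linear_transpose bounded_linear_ident
        bounded_linear_compose[OF bounded_linear_inner_right bounded_linear_matrix_vector])
  moreover have "closed {X :: real^'n^'n. trace X = 1}"
    unfolding trace_def by (intro closed_Collect_eq continuous_intros)
  ultimately show ?thesis
    unfolding compact_eq_bounded_closed admissible_def
    by (auto intro!: closed_Collect_conj rank_le_closed)
qed

text \<open>A continuous function on a compact set attains its maximum, so the
  \<open>GREATEST\<close> in \<open>gamma_k\<close> exists. The arguments below reach
  \<open>gamma_k\<close> through these two facts.\<close>

lemma gamma_k_max:
  fixes A :: "real^'n^'n"
  assumes "admissible k \<noteq> ({} :: (real^'n^'n) set)"
  shows "\<exists>X\<in>admissible k. gamma_k k A T = lambda_min (gramian A T X)"
    and "X \<in> admissible k \<Longrightarrow> lambda_min (gramian A T X) \<le> gamma_k k A T"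
proof -
  let ?f = "\<lambda>X. lambda_min (gramian A T X)"
  have sym: "transpose (gramian A T X) = gramian A T X" if "X \<in> admissible k" for X
    using that by (intro symmetric_gramian) (auto simp: admissible_def psd_def)
  have "continuous_on (admissible k) ?f"
  proof (rule continuous_on_compose2[of "gramian A T ` admissible k" lambda_min])
    show "continuous_on (gramian A T ` admissible k) lambda_min"
      using lambda_min_Lipschitz sym
      by (intro lipschitz_on_continuous_on[of 1] lipschitz_onI) (auto simp: dist_norm)
  qed (auto intro: linear_continuous_on_compose linear_continuous_on linear_conv_bounded_linear[THEN iffD1] linear_gramian)
  then obtain X where X: "X \<in> admissible k" "\<And>Y. Y \<in> admissible k \<Longrightarrow> ?f Y \<le> ?f X"
    using continuous_attains_sup[OF compact_admissible assms] by metis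
  then have "gamma_k k A T = ?f X"
    unfolding gamma_k_def by (intro Greatest_equality) auto
  with X show "\<exists>X\<in>admissible k. gamma_k k A T = ?f X"
    and "X \<in> admissible k \<Longrightarrow> ?f X \<le> gamma_k k A T" for X by auto
qed

section \<open>Square integrals of polynomials\<close>

text \<open>The quadratic form of the Hilbert matrix, that is, the integral over the unit interval
  of the square of the polynomial with coefficients \<open>c 0, ..., c d\<close>.\<close>

definition hilbert_form :: "nat \<Rightarrow> (nat \<Rightarrow> real) \<Rightarrow> real" where
  "hilbert_form d c = (\<Sum>i\<le>d. \<Sum>j\<le>d. c i * c j / real (i + j + 1))"

text \<open>Expand the square and integrate monomials. The substitution \<open>t = T x\<close>
  appears as the weights \<open>T ^ i\<close> on the coefficients.\<close>

lemma has_integral_poly_square: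
  assumes "0 \<le> T"
  shows "((\<lambda>t. (\<Sum>i\<le>d. c i * t ^ i)\<^sup>2) has_integral T * hilbert_form d (\<lambda>i. c i * T ^ i)) {0..T}"
proof -
  have "((\<lambda>t. t ^ (n + 1) / real (n + 1)) has_real_derivative t ^ n) (at t within {0..T})" for n t
    by (rule DERIV_cong[OF DERIV_cdivide[OF DERIV_pow]]) (simp del: of_nat_Suc of_nat_add)
  then have pow: "((\<lambda>t. t ^ n) has_integral (T ^ (n + 1) / real (n + 1) - 0 ^ (n + 1) / real (n + 1))) {0..T}" for n
    using assms
    by (intro fundamental_theorem_of_calculus)
      (auto simp only: has_real_derivative_iff_has_vector_derivative)
  have "((\<lambda>t. c i * c j * t ^ (i + j)) has_integral
      c i * c j * (T ^ (i + j + 1) / real (i + j + 1))) {0..T}" for i j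
    using has_integral_mult_right[OF pow[of "i + j"], of "c i * c j"] by simp
  then have "((\<lambda>t. \<Sum>i\<le>d. \<Sum>j\<le>d. c i * c j * t ^ (i + j)) has_integral
      (\<Sum>i\<le>d. \<Sum>j\<le>d. c i * c j * (T ^ (i + j + 1) / real (i + j + 1)))) {0..T}"
    by (intro has_integral_sum) auto
  moreover have "(\<Sum>i\<le>d. \<Sum>j\<le>d. c i * c j * t ^ (i + j)) = (\<Sum>i\<le>d. c i * t ^ i)\<^sup>2" for t
    by (simp add: power2_eq_square sum_product power_add mult_ac)
  moreover have "(\<Sum>i\<le>d. \<Sum>j\<le>d. c i * c j * (T ^ (i + j + 1) / real (i + j + 1)))
      = T * hilbert_form d (\<lambda>i. c i * T ^ i)"
    by (simp add: hilbert_form_def sum_distrib_left power_add mult_ac)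
  ultimately show ?thesis by simp
qed

lemma integral_poly_square:
  "0 \<le> T \<Longrightarrow> integral {0..T} (\<lambda>t. (\<Sum>i\<le>d. c i * t ^ i)\<^sup>2) = T * hilbert_form d (\<lambda>i. c i * T ^ i)"
  by (rule integral_unique[OF has_integral_poly_square])

lemma hilbert_form_nonneg: "0 \<le> hilbert_form d c"
  using has_integral_nonneg[OF has_integral_poly_square[where T=1 and d=d and c=c]] by simp

lemma hilbert_form_scale: "hilbert_form d (\<lambda>i. r * c i) = r\<^sup>2 * hilbert_form d c"
  by (simp add: hilbert_form_def sum_distrib_left power2_eq_square mult_ac)

text \<open>Parallelogram identity with the nonnegative value at the sum dropped.\<close>

lemma hilbert_form_diff_le:
  "hilbert_form d (\<lambda>i. a i - b i) \<le> 2 * hilbert_form d a + 2 * hilbert_form d b"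
proof -
  have "hilbert_form d (\<lambda>i. a i - b i) + hilbert_form d (\<lambda>i. a i + b i)
      = (\<Sum>i\<le>d. \<Sum>j\<le>d. 2 * (a i * a j / real (i + j + 1)) + 2 * (b i * b j / real (i + j + 1)))"
    unfolding hilbert_form_def sum.distrib[symmetric]
    by (intro sum.cong refl) (simp add: field_simps)
  also have "\<dots> = 2 * hilbert_form d a + 2 * hilbert_form d b"
    by (simp add: hilbert_form_def sum.distrib sum_distrib_left)
  finally show ?thesis using hilbert_form_nonneg[of d "\<lambda>i. a i + b i"] by simp
qed

lemma hilbert_form_Suc_zero: "c (Suc d) = 0 \<Longrightarrow> hilbert_form (Suc d) c = hilbert_form d c"
  by (simp add: hilbert_form_def)

text \<open>The left side is twice the integral of the same square over
  \<open>{0..1/2}\<close>.\<close>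

lemma hilbert_form_half: "hilbert_form d (\<lambda>i. c i * (1 / 2) ^ i) \<le> 2 * hilbert_form d c"
proof -
  let ?f = "\<lambda>t. (\<Sum>i\<le>d. c i * t ^ i)\<^sup>2"
  have "integral {0..1/2} ?f \<le> integral {0..1} ?f"
    by (intro integral_subset_le integrable_continuous_real continuous_intros) auto
  then show ?thesis by (simp add: integral_poly_square)
qed

text \<open>Induction on the degree: \<open>p(x/2) - p(x)/2\<^sup>d\<close> has lower degree, and halving the argument at
  most doubles the integral of \<open>p\<^sup>2\<close>.\<close>

lemma hilbert_form_coefficient_bound:
  "\<exists>C>0. \<forall>c. \<forall>q\<le>d. (c q)\<^sup>2 \<le> C * hilbert_form d c"
proof (induction d)
  case 0
  show ?case by (intro exI[of _ 1]) (auto simp: hilbert_form_def power2_eq_square)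
next
  case (Suc d)
  then obtain C where C: "0 < C" "\<And>c q. q \<le> d \<Longrightarrow> (c q)\<^sup>2 \<le> C * hilbert_form d c" by blast
  define h :: real where "h = (1 / 2) ^ Suc d"
  have h: "0 < h" "h \<le> 1" unfolding h_def by (simp, rule power_le_one) auto
  then have h2: "h\<^sup>2 \<le> 1" by (intro power_le_one) auto
  define C1 where "C1 = C * 6 / h\<^sup>2"
  have "0 < C1" using C(1) h by (simp add: C1_def)
  have low: "(c q)\<^sup>2 \<le> C1 * hilbert_form (Suc d) c" if "q \<le> d" for c q
  proof -
    define r where "r i = c i * (1 / 2) ^ i - h * c i" for i
    have "hilbert_form d r = hilbert_form (Suc d) r"
      by (simp add: hilbert_form_Suc_zero r_def h_def)
    also have "\<dots> \<le> 2 * hilbert_form (Suc d) (\<lambda>i. c i * (1 / 2) ^ i) + 2 * (h\<^sup>2 * hilbert_form (Suc d) c)"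
      unfolding r_def using hilbert_form_diff_le[of "Suc d" "\<lambda>i. c i * (1 / 2) ^ i" "\<lambda>i. h * c i"]
      by (simp only: hilbert_form_scale)
    also have "\<dots> \<le> 2 * (2 * hilbert_form (Suc d) c) + 2 * (1 * hilbert_form (Suc d) c)"
      using h2 by (intro add_mono mult_left_mono hilbert_form_half mult_right_mono hilbert_form_nonneg) auto
    finally have "hilbert_form d r \<le> 6 * hilbert_form (Suc d) c" by simp
    then have r: "(r q)\<^sup>2 \<le> C * (6 * hilbert_form (Suc d) c)"
      using C(2)[OF that, of r] C(1) by (meson mult_left_mono less_imp_le order_trans)
    \<comment> \<open>Passing from \<open>c\<close> to \<open>r\<close> multiplies the coefficient
      of index \<open>q\<close> by \<open>(1 / 2) ^ q - h\<close>, and this factor is at least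
      \<open>h\<close> because \<open>q \<le> d\<close>.\<close>
    have "2 * h \<le> (1 / 2) ^ q"
      using that power_decreasing[of q d "1 / 2 :: real"] by (simp add: h_def)
    then have "h\<^sup>2 \<le> ((1 / 2) ^ q - h)\<^sup>2"
      using h by (intro power_mono) auto
    then have "h\<^sup>2 * (c q)\<^sup>2 \<le> (r q)\<^sup>2"
      unfolding r_def by (metis mult.commute mult_right_mono power_mult_distrib right_diff_distrib zero_le_power2)
    with r have "h\<^sup>2 * (c q)\<^sup>2 \<le> C * (6 * hilbert_form (Suc d) c)" by linarith
    then show ?thesis
      using h by (simp add: C1_def field_simps)
  qed
  \<comment> \<open>The leading term is the polynomial minus its lower part. The form of that single
    term is its squared coefficient over \<open>2 * d + 3\<close>, and the lower part has
    \<open>(d + 1)^2\<close> terms, each bounded through \<open>low\<close>.\<close>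
  define C2 where "C2 = real (2 * d + 3) * (2 + 2 * (real (Suc d))\<^sup>2 * C1)"
  have "0 < C2" using \<open>0 < C1\<close> 
    unfolding C2_def by (intro mult_pos_pos add_pos_nonneg) auto
  have top: "(c (Suc d))\<^sup>2 \<le> C2 * hilbert_form (Suc d) c" for c
  proof -
    define H where "H = hilbert_form (Suc d) c"
    have CH: "0 \<le> C1 * H"
      using \<open>0 < C1\<close> hilbert_form_nonneg[of "Suc d" c] by (simp add: H_def)
    define e where "e i = (if i = Suc d then 0 else c i)" for i
    define f where "f i = (if i = Suc d then c i else 0)" for i
    have "(c (Suc d))\<^sup>2 / real (2 * d + 3) = hilbert_form (Suc d) f"
      by (simp add: hilbert_form_def f_def power2_eq_square cong: sum.cong_simp)
    also have "\<dots> = hilbert_form (Suc d) (\<lambda>i. c i - e i)"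
      by (rule arg_cong[of _ _ "hilbert_form (Suc d)"]) (auto simp: f_def e_def)
    also have "\<dots> \<le> 2 * H + 2 * hilbert_form (Suc d) e"
      unfolding H_def by (rule hilbert_form_diff_le)
    finally have *: "(c (Suc d))\<^sup>2 / real (2 * d + 3) \<le> 2 * H + 2 * hilbert_form (Suc d) e" .
    have "hilbert_form (Suc d) e = hilbert_form d e"
      by (simp add: hilbert_form_Suc_zero e_def)
    also have "\<dots> = hilbert_form d c"
      unfolding hilbert_form_def by (intro sum.cong refl) (auto simp: e_def)
    also have "\<dots> \<le> (\<Sum>i\<le>d. \<Sum>j\<le>d. C1 * H)"
      unfolding hilbert_form_def
    proof (intro sum_mono)
      fix i j assume "i \<in> {..d}" "j \<in> {..d}"
      then have "\<bar>c i\<bar> \<le> sqrt (C1 * H)" "\<bar>c j\<bar> \<le> sqrt (C1 * H)"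
        using low[of i c] low[of j c] by (auto simp: H_def real_le_rsqrt)
      then have "\<bar>c i\<bar> * \<bar>c j\<bar> \<le> sqrt (C1 * H) * sqrt (C1 * H)"
        using CH by (intro mult_mono) auto
      also have "\<dots> = C1 * H"
        using CH by simp
      finally have "\<bar>c i * c j\<bar> \<le> C1 * H" by (simp add: abs_mult)
      moreover have "c i * c j / real (i + j + 1) \<le> \<bar>c i * c j\<bar>"
        by (simp add: divide_le_eq) (smt (verit, best) mult_le_cancel_left1 mult_nonneg_nonneg of_nat_0_le_iff)
      ultimately show "c i * c j / real (i + j + 1) \<le> C1 * H" by linarith
    qed
    also have "\<dots> = (real (Suc d))\<^sup>2 * C1 * H" by (simp add: power2_eq_square)
    finally have "hilbert_form (Suc d) e \<le> (real (Suc d))\<^sup>2 * C1 * H" .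
    with * have "(c (Suc d))\<^sup>2 / real (2 * d + 3) \<le> (2 + 2 * (real (Suc d))\<^sup>2 * C1) * H"
      by (simp add: algebra_simps)
    then have "(c (Suc d))\<^sup>2 \<le> (2 + 2 * (real (Suc d))\<^sup>2 * C1) * H * real (2 * d + 3)"
      by (subst (asm) pos_divide_le_eq) auto
    then show ?thesis by (simp add: C2_def H_def mult_ac)
  qed
  show ?case
  proof (intro exI[of _ "max C1 C2"] conjI allI impI)
    fix c :: "nat \<Rightarrow> real" and q assume "q \<le> Suc d"
    then consider "q \<le> d" | "q = Suc d" by linarith
    then show "(c q)\<^sup>2 \<le> max C1 C2 * hilbert_form (Suc d) c"
    proof cases
      case 1
      then show ?thesis using low[OF 1, of c] hilbert_form_nonneg[of "Suc d" c]
        by (meson max.cobounded1 mult_right_mono order_trans)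
    next
      case 2
      then show ?thesis using top[of c] hilbert_form_nonneg[of "Suc d" c]
        by (metis max.cobounded2 mult_right_mono order_trans)
    qed
  qed (use \<open>0 < C1\<close> in auto)
qed

text \<open>The squared \<open>L^2\<close> distance on the unit interval from \<open>x^d\<close> to
  the polynomials of lower degree.\<close>

definition monic_inf :: "nat \<Rightarrow> real" where
  "monic_inf d = (INF c\<in>{c. c d = 1}. hilbert_form d c)"

lemma bdd_below_hilbert_form: "bdd_below (hilbert_form d ` S)"
  by (rule bdd_belowI[of _ 0]) (auto simp: hilbert_form_nonneg)

text \<open>Homogeneous version of the infimum: divide by the leading coefficient unless it
  vanishes.\<close>

lemma monic_inf_le: "monic_inf d * (c d)\<^sup>2 \<le> hilbert_form d c"
proof (cases "c d = 0")
  case False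
  have "monic_inf d \<le> hilbert_form d (\<lambda>i. (1 / c d) * c i)"
    unfolding monic_inf_def using False by (intro cINF_lower bdd_below_hilbert_form) auto
  then show ?thesis
    unfolding hilbert_form_scale using False by (simp add: field_simps)
qed (simp add: hilbert_form_nonneg)

text \<open>The coefficient bound at \<open>q = d\<close> says that a monic polynomial has form at
  least \<open>1 / C\<close>.\<close>

lemma monic_inf_pos: "0 < monic_inf d"
proof -
  obtain C where C: "0 < C" "\<And>c. (c d)\<^sup>2 \<le> C * hilbert_form d c"
    using hilbert_form_coefficient_bound[of d] by blast
  have "1 / C \<le> monic_inf d"
    unfolding monic_inf_def
  proof (rule cINF_greatest)
    show "{c. c d = (1::real)} \<noteq> {}" by auto
    show "1 / C \<le> hilbert_form d c" if "c \<in> {c. c d = 1}" for c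
      using C(2)[of c] that C(1) by (simp add: field_simps)
  qed
  then show ?thesis using C(1) by (meson divide_pos_pos less_le_trans zero_less_one)
qed

lemma monic_inf_approx:
  assumes "0 < e"
  obtains c where "c d = 1" "hilbert_form d c < monic_inf d + e"
proof -
  have "\<exists>c\<in>{c. c d = 1}. hilbert_form d c < monic_inf d + e"
    unfolding monic_inf_def using assms
    by (subst cINF_less_iff[symmetric]) (auto intro: bdd_below_hilbert_form)
  then show ?thesis using that by blast
qed

lemma monic_inf_0: "monic_inf 0 = 1"
proof -
  have "hilbert_form 0 ` {c. c 0 = 1} = {1}"
    by (auto simp: hilbert_form_def image_iff)
  then show ?thesis by (simp add: monic_inf_def)
qed

section \<open>Short-time bounds for a fixed weight\<close>

text \<open>\<open>flow_Taylor\<close> with a constant that is uniform in \<open>t\<close> on the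
  unit interval.\<close>

lemma flow_remainder:
  assumes "0 \<le> t" "t \<le> 1"
  shows "norm (flow M t v - (\<Sum>q<j. (t ^ q / fact q) *\<^sub>R (matrix_power M q *v v)))
    \<le> t ^ j * norm M ^ j * exp (norm M) * norm v"
proof -
  have "(\<bar>t\<bar> * norm M) ^ j / fact j \<le> (\<bar>t\<bar> * norm M) ^ j / 1"
    by (intro divide_left_mono fact_ge_1) auto
  then have "(\<bar>t\<bar> * norm M) ^ j / fact j \<le> t ^ j * norm M ^ j"
    using assms by (simp add: power_mult_distrib)
  moreover have "exp (\<bar>t\<bar> * norm M) \<le> exp (norm M)"
    using assms by (simp add: mult_left_le_one_le)
  ultimately have "(\<bar>t\<bar> * norm M) ^ j / fact j * exp (\<bar>t\<bar> * norm M) * norm v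
      \<le> t ^ j * norm M ^ j * exp (norm M) * norm v"
    using assms by (intro mult_mono) auto
  then show ?thesis using flow_Taylor[where M=M and t=t and v=v and j=j] by linarith
qed

lemma lambda_min_gramian_le:
  assumes "transpose X = X"
  shows "lambda_min (gramian A T X) * (norm v)\<^sup>2
    \<le> integral {0..T} (\<lambda>t. flow (transpose A) t v \<bullet> (X *v flow (transpose A) t v))"
  using lambda_min_Rayleigh(2)[OF symmetric_gramian[OF assms], of A T v] by (simp add: gramian_form)

text \<open>Weighted Young inequality. A small \<open>r\<close> keeps the factor of
  \<open>x^2\<close> near 1, as a sharp leading constant demands.\<close>

lemma power2_add_le:
  fixes x y r :: real
  assumes "0 < r"
  shows "(x + y)\<^sup>2 \<le> (1 + r) * x\<^sup>2 + (1 + 1 / r) * y\<^sup>2"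
proof -
  have "0 \<le> (r * x - y)\<^sup>2 / r" using assms by simp
  also have "\<dots> = r * x\<^sup>2 - 2 * x * y + y\<^sup>2 / r"
    using assms by (simp add: power2_eq_square field_simps)
  finally show ?thesis using assms by (simp add: power2_sum algebra_simps)
qed

text \<open>The test vector \<open>u = \<Sum>\<^sub>j T\<^sup>j (d-j)! c\<^bsub>d-j\<^esub> M\<^sup>j v\<close> is chosen so that, modulo the kernel of
  \<open>X\<close>, \<open>flow M t u\<close> equals \<open>p(t) M\<^sup>d v\<close> up to \<open>O(T\<^sup>d\<^sup>+\<^sup>1)\<close>, where \<open>p(t) = \<Sum>\<^sub>i c\<^sub>i T\<^bsup>d-i\<^esup> t\<^sup>i\<close>.\<close>

lemma lambda_min_gramian_upper:
  fixes A :: "real^'n^'n" and c :: "nat \<Rightarrow> real"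
  assumes "c d = 1"
  obtains C where "0 \<le> C" "\<And>T X v. 0 < T \<Longrightarrow> T \<le> 1 \<Longrightarrow> psd X \<Longrightarrow> trace X = 1 \<Longrightarrow> norm v = 1 \<Longrightarrow>
      (\<And>q. q < d \<Longrightarrow> X *v (matrix_power (transpose A) q *v v) = 0) \<Longrightarrow> C * T \<le> fact d \<Longrightarrow>
      lambda_min (gramian A T X) * (fact d - C * T)\<^sup>2 \<le> T ^ (2 * d + 1) *
        (hilbert_form d c * ((matrix_power (transpose A) d *v v) \<bullet> (X *v (matrix_power (transpose A) d *v v))) + C * T)"
proof -
  define M where "M = transpose A"
  \<comment> \<open>All constants depend on \<open>A\<close>, \<open>c\<close> and \<open>d\<close>
    alone, which makes the bound uniform in \<open>X\<close> and \<open>v\<close>: \<open>N\<close>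
    bounds \<open>norm X\<close>, \<open>K1\<close> the deviation of the test vector from
    \<open>fact d\<close> times \<open>v\<close>, \<open>K2\<close> its Taylor remainder,
    \<open>K3\<close> the polynomial, and \<open>K4\<close> the terms of the form that involve the
    remainder.\<close>
  define N where "N = (real CARD('n))\<^sup>2"
  define K where "K = norm M ^ Suc d * exp (norm M)"
  define K1 where "K1 = (\<Sum>j\<le>d. fact (d - j) * \<bar>c (d - j)\<bar> * norm M ^ j)"
  define K2 where "K2 = (\<Sum>j\<le>d. fact (d - j) * \<bar>c (d - j)\<bar> * K)"
  define K3 where "K3 = (\<Sum>i\<le>d. \<bar>c i\<bar>)"
  define K4 where "K4 = 2 * K3 * N * norm M ^ d * K2 + N * K2\<^sup>2"
  have nn: "0 \<le> N" "0 \<le> K" "0 \<le> K1" "0 \<le> K2" "0 \<le> K3" "0 \<le> K4"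
    by (auto simp: N_def K_def K1_def K2_def K3_def K4_def sum_nonneg)
  show ?thesis
  proof (rule that[of "max K1 K4"])
    show "0 \<le> max K1 K4" using nn by auto
    fix T :: real and X :: "real^'n^'n" and v :: "real^'n"
    assume T: "0 < T" "T \<le> 1" and X: "psd X" "trace X = 1" and v: "norm v = 1"
      and ker: "\<And>q. q < d \<Longrightarrow> X *v (matrix_power (transpose A) q *v v) = 0"
      and small: "max K1 K4 * T \<le> fact d"
    have sym: "transpose X = X" using X by (simp add: psd_def)
    have XN: "norm X \<le> N" using psd_norm_le[OF X] by (simp add: N_def)
    define z where "z = matrix_power M d *v v"
    have z: "norm z \<le> norm M ^ d"
      using norm_matrix_power_vector_le[of M d v] v by (simp add: z_def)
    define a where "a j = T ^ j * fact (d - j) * c (d - j)" for j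
    have abs_a: "\<bar>a j\<bar> = T ^ j * (fact (d - j) * \<bar>c (d - j)\<bar>)" for j
      using T by (simp add: a_def abs_mult)
    define u where "u = (\<Sum>j\<le>d. a j *\<^sub>R (matrix_power M j *v v))"
    \<comment> \<open>The term \<open>j = 0\<close> is \<open>fact d\<close> times \<open>v\<close>,
      because \<open>c d = 1\<close>; all others carry a factor \<open>T\<close>.\<close>
    have u: "fact d - K1 * T \<le> norm u"
    proof -
      have "u = fact d *\<^sub>R v + (\<Sum>j\<in>{1..d}. a j *\<^sub>R (matrix_power M j *v v))"
        unfolding u_def atMost_atLeast0 by (subst sum.atLeast_Suc_atMost) (auto simp: a_def assms)
      moreover have "norm (\<Sum>j\<in>{1..d}. a j *\<^sub>R (matrix_power M j *v v)) \<le> K1 * T"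
      proof -
        have "norm (\<Sum>j\<in>{1..d}. a j *\<^sub>R (matrix_power M j *v v))
            \<le> (\<Sum>j\<in>{1..d}. T * (fact (d - j) * \<bar>c (d - j)\<bar> * norm M ^ j))"
        proof (rule sum_norm_le)
          fix j assume j: "j \<in> {1..d}"
          have "norm (a j *\<^sub>R (matrix_power M j *v v)) \<le> \<bar>a j\<bar> * norm M ^ j"
            using norm_matrix_power_vector_le[of M j v] v by (simp add: mult_left_mono)
          also have "\<dots> = T ^ j * (fact (d - j) * \<bar>c (d - j)\<bar> * norm M ^ j)"
            by (simp add: abs_a)
          also have "\<dots> \<le> T * (fact (d - j) * \<bar>c (d - j)\<bar> * norm M ^ j)"
            using T j power_decreasing[of 1 j T] by (intro mult_right_mono) auto
          finally show "norm (a j *\<^sub>R (matrix_power M j *v v)) \<le> \<dots>" .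
        qed
        also have "\<dots> \<le> (\<Sum>j\<le>d. T * (fact (d - j) * \<bar>c (d - j)\<bar> * norm M ^ j))"
          using T by (intro sum_mono2) auto
        finally show ?thesis by (simp add: K1_def sum_distrib_left mult.commute)
      qed
      ultimately show ?thesis
        using v norm_diff_ineq[of "fact d *\<^sub>R v" "\<Sum>j\<in>{1..d}. a j *\<^sub>R (matrix_power M j *v v)"]
        by simp
    qed
    define p where "p t = (\<Sum>i\<le>d. (T ^ (d - i) * c i) * t ^ i)" for t
    \<comment> \<open>The expansion of the \<open>j\<close>-th term stops at order
      \<open>d - j\<close>, where the total power of \<open>M\<close> reaches \<open>d\<close>; its
      terms of smaller total power are annihilated by \<open>X\<close>.\<close>
    define r where "r j t = flow M t (matrix_power M j *v v)
        - (\<Sum>q<Suc d - j. (t ^ q / fact q) *\<^sub>R (matrix_power M q *v (matrix_power M j *v v)))" for j t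
    define R where "R t = (\<Sum>j\<le>d. a j *\<^sub>R r j t)" for t
    have Xflow: "X *v flow M t u = X *v (p t *\<^sub>R z + R t)" for t
    proof -
      have 1: "X *v flow M t (matrix_power M j *v v) = (t ^ (d - j) / fact (d - j)) *\<^sub>R (X *v z) + X *v r j t"
        if j: "j \<le> d" for j
      proof -
        have zero: "X *v (matrix_power M q *v (matrix_power M j *v v)) = 0" if "q < d - j" for q
          using ker[of "q + j"] that by (simp add: matrix_power_vector_add M_def)
        have top: "matrix_power M (d - j) *v (matrix_power M j *v v) = z"
          using j by (simp add: matrix_power_vector_add z_def)
        have "X *v (\<Sum>q<Suc d - j. (t ^ q / fact q) *\<^sub>R (matrix_power M q *v (matrix_power M j *v v)))
            = (t ^ (d - j) / fact (d - j)) *\<^sub>R (X *v z)"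
          using j zero
          by (simp add: Suc_diff_le top linear_sum[OF matrix_vector_mul_linear] matrix_vector_right_distrib
              matrix_vector_mult_scaleR)
        then show ?thesis
          by (simp add: r_def matrix_vector_mult_diff_distrib)
      qed
      have "flow M t u = (\<Sum>j\<le>d. a j *\<^sub>R flow M t (matrix_power M j *v v))"
        unfolding u_def by (simp add: linear_sum[OF matrix_vector_mul_linear] matrix_vector_mult_scaleR)
      then have "X *v flow M t u = (\<Sum>j\<le>d. a j *\<^sub>R (X *v flow M t (matrix_power M j *v v)))"
        by (simp add: linear_sum[OF matrix_vector_mul_linear] matrix_vector_mult_scaleR)
      also have "\<dots> = (\<Sum>j\<le>d. (a j * (t ^ (d - j) / fact (d - j))) *\<^sub>R (X *v z)) + X *v R t"
        unfolding R_def
        by (simp add: 1 scaleR_add_right sum.distrib linear_sum[OF matrix_vector_mul_linear]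
            matrix_vector_mult_scaleR)
      also have "(\<Sum>j\<le>d. (a j * (t ^ (d - j) / fact (d - j))) *\<^sub>R (X *v z)) = p t *\<^sub>R (X *v z)"
        unfolding scaleR_left.sum[symmetric] p_def
        by (rule arg_cong[where f = "\<lambda>s. s *\<^sub>R (X *v z)"],
            rule sum.reindex_bij_witness[of _ "\<lambda>i. d - i" "\<lambda>i. d - i"]) (auto simp: a_def)
      finally show ?thesis by (simp add: matrix_vector_right_distrib matrix_vector_mult_scaleR)
    qed
    have R: "norm (R t) \<le> T ^ Suc d * K2" if t: "t \<in> {0..T}" for t
    proof -
      have "norm (R t) \<le> (\<Sum>j\<le>d. T ^ Suc d * (fact (d - j) * \<bar>c (d - j)\<bar> * K))"
        unfolding R_def
      proof (rule sum_norm_le)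
        fix j assume j: "j \<in> {..d}"
        have "norm (r j t) \<le> t ^ (Suc d - j) * norm M ^ (Suc d - j) * exp (norm M) * norm (matrix_power M j *v v)"
          unfolding r_def using t T by (intro flow_remainder) auto
        also have "\<dots> \<le> T ^ (Suc d - j) * norm M ^ (Suc d - j) * exp (norm M) * norm M ^ j"
          using t norm_matrix_power_vector_le[of M j v] v by (intro mult_mono power_mono) auto
        also have "\<dots> = T ^ (Suc d - j) * K"
          using j power_add[of "norm M" "Suc d - j" j] by (simp add: K_def mult_ac)
        finally have "\<bar>a j\<bar> * norm (r j t) \<le> \<bar>a j\<bar> * (T ^ (Suc d - j) * K)"
          by (intro mult_left_mono) auto
        also have "\<dots> = T ^ j * T ^ (Suc d - j) * (fact (d - j) * \<bar>c (d - j)\<bar> * K)"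
          by (simp add: abs_a mult_ac)
        also have "T ^ j * T ^ (Suc d - j) = T ^ Suc d"
          using j by (simp add: power_add[symmetric])
        finally show "norm (a j *\<^sub>R r j t) \<le> T ^ Suc d * (fact (d - j) * \<bar>c (d - j)\<bar> * K)" by simp
      qed
      then show ?thesis by (simp add: K2_def sum_distrib_left)
    qed
    have p: "\<bar>p t\<bar> \<le> T ^ d * K3" if t: "t \<in> {0..T}" for t
    proof -
      have "\<bar>p t\<bar> \<le> (\<Sum>i\<le>d. T ^ d * \<bar>c i\<bar>)"
        unfolding p_def
      proof (rule order_trans[OF sum_abs sum_mono])
        fix i assume i: "i \<in> {..d}"
        have "\<bar>T ^ (d - i) * c i * t ^ i\<bar> = T ^ (d - i) * t ^ i * \<bar>c i\<bar>"
          using T t by (simp add: abs_mult)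
        also have "\<dots> \<le> T ^ (d - i) * T ^ i * \<bar>c i\<bar>"
          using T t by (intro mult_mono power_mono) auto
        also have "T ^ (d - i) * T ^ i = T ^ d"
          using i by (simp add: power_add[symmetric])
        finally show "\<bar>T ^ (d - i) * c i * t ^ i\<bar> \<le> T ^ d * \<bar>c i\<bar>" .
      qed
      then show ?thesis by (simp add: K3_def sum_distrib_left)
    qed
    have form: "flow M t u \<bullet> (X *v flow M t u) \<le> (z \<bullet> (X *v z)) * (p t)\<^sup>2 + T ^ (2 * d + 1) * K4"
      if t: "t \<in> {0..T}" for t
    proof -
      \<comment> \<open>By symmetry of \<open>X\<close>, the form depends on a vector only through
        its image under \<open>X\<close>.\<close>
      have "flow M t u \<bullet> (X *v flow M t u) = (p t *\<^sub>R z + R t) \<bullet> (X *v (p t *\<^sub>R z + R t))"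
        using Xflow[of t] by (metis symmetric_inner_commute[OF sym])
      also have "\<dots> = (z \<bullet> (X *v z)) * (p t)\<^sup>2 + 2 * p t * (z \<bullet> (X *v R t)) + R t \<bullet> (X *v R t)"
        by (simp add: quadratic_form_add[OF sym] matrix_vector_mult_scaleR power2_eq_square mult_ac)
      finally have eq: "flow M t u \<bullet> (X *v flow M t u)
          = (z \<bullet> (X *v z)) * (p t)\<^sup>2 + 2 * p t * (z \<bullet> (X *v R t)) + R t \<bullet> (X *v R t)" .
      have zR: "\<bar>z \<bullet> (X *v R t)\<bar> \<le> N * norm M ^ d * (T ^ Suc d * K2)"
      proof -
        have "\<bar>z \<bullet> (X *v R t)\<bar> \<le> norm X * norm z * norm (R t)" by (rule inner_matrix_le)
        also have "\<dots> \<le> N * norm M ^ d * (T ^ Suc d * K2)"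
          using XN z R[OF t] nn by (intro mult_mono) auto
        finally show ?thesis .
      qed
      have "p t * (z \<bullet> (X *v R t)) \<le> \<bar>p t\<bar> * \<bar>z \<bullet> (X *v R t)\<bar>"
        by (metis abs_ge_self abs_mult)
      also have "\<dots> \<le> (T ^ d * K3) * (N * norm M ^ d * (T ^ Suc d * K2))"
        using T nn by (intro mult_mono p[OF t] zR) auto
      also have "\<dots> = T ^ (2 * d + 1) * (K3 * N * norm M ^ d * K2)"
        by (simp add: power_add mult_2)
      finally have 1: "p t * (z \<bullet> (X *v R t)) \<le> T ^ (2 * d + 1) * (K3 * N * norm M ^ d * K2)" .
      have "R t \<bullet> (X *v R t) \<le> norm X * norm (R t) * norm (R t)"
        using inner_matrix_le[of "R t" X "R t"] by linarith
      also have "\<dots> \<le> N * (T ^ Suc d * K2) * (T ^ Suc d * K2)"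
        using XN R[OF t] nn T by (intro mult_mono) auto
      also have "\<dots> = T ^ (2 * d + 1) * (N * K2\<^sup>2) * T"
        by (simp add: power_add mult_2 power2_eq_square)
      also have "\<dots> \<le> T ^ (2 * d + 1) * (N * K2\<^sup>2) * 1"
        using T nn by (intro mult_left_mono) auto
      finally have 2: "R t \<bullet> (X *v R t) \<le> T ^ (2 * d + 1) * (N * K2\<^sup>2)" by simp
      have "T ^ (2 * d + 1) * K4
          = 2 * (T ^ (2 * d + 1) * (K3 * N * norm M ^ d * K2)) + T ^ (2 * d + 1) * (N * K2\<^sup>2)"
        by (simp only: K4_def distrib_left mult_ac)
      then show ?thesis using eq 1 2 by linarith
    qed
    have cont: "continuous_on {0..T} p" unfolding p_def by (intro continuous_intros)
    have "lambda_min (gramian A T X) * (norm u)\<^sup>2 \<le> integral {0..T} (\<lambda>t. flow M t u \<bullet> (X *v flow M t u))"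
      unfolding M_def by (rule lambda_min_gramian_le[OF sym])
    also have "\<dots> \<le> integral {0..T} (\<lambda>t. (z \<bullet> (X *v z)) * (p t)\<^sup>2 + T ^ (2 * d + 1) * K4)"
      using form by (intro integral_le integrable_continuous_real continuous_on_flow_form continuous_intros cont) auto
    also have "\<dots> = (z \<bullet> (X *v z)) * integral {0..T} (\<lambda>t. (p t)\<^sup>2) + T * (T ^ (2 * d + 1) * K4)"
      using T by (subst integral_add) (auto intro!: integrable_continuous_real continuous_intros cont)
    also have "integral {0..T} (\<lambda>t. (p t)\<^sup>2) = T * hilbert_form d (\<lambda>i. T ^ (d - i) * c i * T ^ i)"
      unfolding p_def using T by (intro integral_poly_square) auto
    also have "hilbert_form d (\<lambda>i. T ^ (d - i) * c i * T ^ i) = hilbert_form d (\<lambda>i. T ^ d * c i)"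
      unfolding hilbert_form_def
    proof (intro sum.cong refl)
      have *: "T ^ (d - i) * c i * T ^ i = T ^ d * c i" if "i \<in> {..d}" for i
        using that power_add[of T "d - i" i] by simp
      show "T ^ (d - i) * c i * T ^ i * (T ^ (d - j) * c j * T ^ j) / real (i + j + 1)
          = T ^ d * c i * (T ^ d * c j) / real (i + j + 1)" if "i \<in> {..d}" "j \<in> {..d}" for i j
        by (simp only: *[OF that(1)] *[OF that(2)])
    qed
    also have "(z \<bullet> (X *v z)) * (T * hilbert_form d (\<lambda>i. T ^ d * c i)) + T * (T ^ (2 * d + 1) * K4)
        = T ^ (2 * d + 1) * (hilbert_form d c * (z \<bullet> (X *v z)) + K4 * T)"
    proof -
      have "T ^ (2 * d + 1) = (T ^ d)\<^sup>2 * T" by (simp add: power_mult[symmetric] mult.commute)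
      then show ?thesis unfolding hilbert_form_scale by (simp only: distrib_left distrib_right mult_ac)
    qed
    finally have main: "lambda_min (gramian A T X) * (norm u)\<^sup>2
        \<le> T ^ (2 * d + 1) * (hilbert_form d c * (z \<bullet> (X *v z)) + K4 * T)" .
    have "fact d - max K1 K4 * T \<le> norm u"
      using u T mult_right_mono[of K1 "max K1 K4" T] by linarith
    \<comment> \<open>\<open>small\<close> makes the base nonnegative, so squaring preserves the
      inequality.\<close>
    then have "(fact d - max K1 K4 * T)\<^sup>2 \<le> (norm u)\<^sup>2"
      using small by (intro power_mono) auto
    then have "lambda_min (gramian A T X) * (fact d - max K1 K4 * T)\<^sup>2
        \<le> lambda_min (gramian A T X) * (norm u)\<^sup>2"
      by (intro mult_left_mono lambda_min_gramian_nonneg X)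
    also note main
    also have "T ^ (2 * d + 1) * (hilbert_form d c * (z \<bullet> (X *v z)) + K4 * T)
        \<le> T ^ (2 * d + 1) * (hilbert_form d c * (z \<bullet> (X *v z)) + max K1 K4 * T)"
      using T by (intro mult_left_mono add_left_mono mult_right_mono) auto
    finally show "lambda_min (gramian A T X) * (fact d - max K1 K4 * T)\<^sup>2 \<le> T ^ (2 * d + 1) *
        (hilbert_form d c * ((matrix_power (transpose A) d *v v) \<bullet> (X *v (matrix_power (transpose A) d *v v))) + max K1 K4 * T)"
      by (simp add: z_def M_def)
  qed
qed

text \<open>A small Gramian form forces the moments \<open>a \<bullet> (X *v (M^q v))\<close> to be
  small, with \<open>M = transpose A\<close>. Cauchy-Schwarz bounds the square of
  \<open>a \<bullet> (X *v flow M t v)\<close> by \<open>a \<bullet> (X *v a)\<close> times the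
  Gramian integrand, and the Taylor polynomial of that function of \<open>t\<close> has the moments
  over \<open>fact q\<close> as coefficients. The error is smaller than
  \<open>T ^ (2 * d + 1)\<close> by a factor \<open>T^2\<close>; \<open>a\<close> and
  \<open>\<delta>\<close> stay free for later choice.\<close>

lemma gramian_moment_bound:
  fixes A :: "real^'n^'n"
  assumes X: "psd X"
  obtains C where "0 \<le> C" "\<And>T v a \<delta>. 0 < T \<Longrightarrow> T \<le> 1 \<Longrightarrow> norm v = 1 \<Longrightarrow> 0 < \<delta> \<Longrightarrow>
    T * hilbert_form d (\<lambda>q. (a \<bullet> (X *v (matrix_power (transpose A) q *v v))) / fact q * T ^ q)
    \<le> (1 + \<delta>) * (a \<bullet> (X *v a)) * (v \<bullet> (gramian A T X *v v)) + (1 + 1 / \<delta>) * C * (norm a)\<^sup>2 * T ^ (2 * d + 3)"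
proof -
  define M where "M = transpose A"
  define K where "K = norm X * (norm M ^ Suc d * exp (norm M))"
  show ?thesis
  proof (rule that[of "K\<^sup>2"])
    fix T \<delta> :: real and v a :: "real^'n"
    assume T: "0 < T" "T \<le> 1" and v: "norm v = 1" and \<delta>: "0 < \<delta>"
    define g where "g t = flow M t v \<bullet> (X *v flow M t v)" for t
    define p where "p t = (\<Sum>q\<le>d. (a \<bullet> (X *v (matrix_power M q *v v))) / fact q * t ^ q)" for t
    have pt: "(p t)\<^sup>2 \<le> (1 + \<delta>) * (a \<bullet> (X *v a)) * g t + (1 + 1 / \<delta>) * (K * norm a * T ^ Suc d)\<^sup>2"
      if t: "t \<in> {0..T}" for t
    proof -
      define r where "r = flow M t v - (\<Sum>q<Suc d. (t ^ q / fact q) *\<^sub>R (matrix_power M q *v v))"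
      have "p t = a \<bullet> (X *v (\<Sum>q<Suc d. (t ^ q / fact q) *\<^sub>R (matrix_power M q *v v)))"
        unfolding p_def lessThan_Suc_atMost
        by (simp add: linear_sum[OF matrix_vector_mul_linear] matrix_vector_mult_scaleR inner_sum_right mult.commute)
      then have "p t = a \<bullet> (X *v flow M t v) + - (a \<bullet> (X *v r))"
        by (simp add: r_def matrix_vector_mult_diff_distrib inner_diff_right)
      then have "(p t)\<^sup>2 \<le> (1 + \<delta>) * (a \<bullet> (X *v flow M t v))\<^sup>2 + (1 + 1 / \<delta>) * (a \<bullet> (X *v r))\<^sup>2"
        using power2_add_le[OF \<delta>, of "a \<bullet> (X *v flow M t v)" "- (a \<bullet> (X *v r))"] by simp
      also have "\<dots> \<le> (1 + \<delta>) * ((a \<bullet> (X *v a)) * g t) + (1 + 1 / \<delta>) * (K * norm a * T ^ Suc d)\<^sup>2"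
      proof (intro add_mono mult_left_mono)
        show "(a \<bullet> (X *v flow M t v))\<^sup>2 \<le> (a \<bullet> (X *v a)) * g t"
          unfolding g_def by (rule psd_Cauchy_Schwarz[OF X])
        have "norm r \<le> t ^ Suc d * norm M ^ Suc d * exp (norm M) * norm v"
          unfolding r_def using t T by (intro flow_remainder) auto
        also have "\<dots> \<le> T ^ Suc d * norm M ^ Suc d * exp (norm M) * 1"
          using t v by (intro mult_mono power_mono) auto
        finally have r: "norm r \<le> T ^ Suc d * norm M ^ Suc d * exp (norm M)" by simp
        have "\<bar>a \<bullet> (X *v r)\<bar> \<le> norm X * norm a * norm r" by (rule inner_matrix_le)
        also have "\<dots> \<le> norm X * norm a * (T ^ Suc d * norm M ^ Suc d * exp (norm M))"
          by (intro mult_left_mono r) auto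
        finally have "\<bar>a \<bullet> (X *v r)\<bar> \<le> K * norm a * T ^ Suc d" by (simp add: K_def mult_ac)
        then show "(a \<bullet> (X *v r))\<^sup>2 \<le> (K * norm a * T ^ Suc d)\<^sup>2"
          by (rule power2_le_iff_abs_le[THEN iffD2, rotated]) (use T in \<open>auto simp: K_def\<close>)
      qed (use \<delta> in auto)
      finally show ?thesis by (simp add: mult.assoc)
    qed
    have cont: "continuous_on {0..T} p" unfolding p_def by (intro continuous_intros)
    have cont': "continuous_on {0..T} g" unfolding g_def by (rule continuous_on_flow_form)
    have "T * hilbert_form d (\<lambda>q. (a \<bullet> (X *v (matrix_power M q *v v))) / fact q * T ^ q)
        = integral {0..T} (\<lambda>t. (p t)\<^sup>2)"
      unfolding p_def using T by (subst integral_poly_square) auto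
    also have "\<dots> \<le> integral {0..T} (\<lambda>t. (1 + \<delta>) * (a \<bullet> (X *v a)) * g t + (1 + 1 / \<delta>) * (K * norm a * T ^ Suc d)\<^sup>2)"
      using pt by (intro integral_le integrable_continuous_real continuous_intros cont cont') auto
    also have "\<dots> = (1 + \<delta>) * (a \<bullet> (X *v a)) * integral {0..T} g + T * ((1 + 1 / \<delta>) * (K * norm a * T ^ Suc d)\<^sup>2)"
      using T by (subst integral_add) (auto intro!: integrable_continuous_real continuous_intros cont')
    also have "integral {0..T} g = v \<bullet> (gramian A T X *v v)"
      unfolding gramian_form g_def M_def ..
    also have "T * ((1 + 1 / \<delta>) * (K * norm a * T ^ Suc d)\<^sup>2)
        = (1 + 1 / \<delta>) * K\<^sup>2 * (norm a)\<^sup>2 * (T * (T ^ Suc d)\<^sup>2)"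
      by (simp only: power_mult_distrib mult_ac)
    also have "T * (T ^ Suc d)\<^sup>2 = T ^ (2 * d + 3)"
      by (simp add: power_add mult_2 power2_eq_square numeral_3_eq_3)
    finally show "T * hilbert_form d (\<lambda>q. (a \<bullet> (X *v (matrix_power (transpose A) q *v v))) / fact q * T ^ q)
      \<le> (1 + \<delta>) * (a \<bullet> (X *v a)) * (v \<bullet> (gramian A T X *v v)) + (1 + 1 / \<delta>) * K\<^sup>2 * (norm a)\<^sup>2 * T ^ (2 * d + 3)"
      by (simp add: M_def)
  qed simp
qed

section \<open>Leading asymptotics\<close>

abbreviation top_form :: "nat \<Rightarrow> real^'n^'n \<Rightarrow> real^'n^'n \<Rightarrow> real^'n \<Rightarrow> real" where
  "top_form d A X v \<equiv>
    (matrix_power (transpose A) d *v v) \<bullet> (X *v (matrix_power (transpose A) d *v v))"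

text \<open>The unit vectors in the unobservable subspace of order \<open>d\<close> for the pair
  \<open>transpose A\<close>, \<open>X\<close>. Normalising makes the set compact, and empty exactly
  when that subspace is trivial; for \<open>d = 0\<close> it is the whole unit sphere.\<close>

definition unobservable :: "nat \<Rightarrow> real^'n^'n \<Rightarrow> real^'n^'n \<Rightarrow> (real^'n) set" where
  "unobservable d A X = {v. norm v = 1 \<and> (\<forall>q<d. X *v (matrix_power (transpose A) q *v v) = 0)}"

text \<open>By contradiction: failure yields times \<open>T i\<close> tending to 0 and unit vectors
  \<open>v i\<close> whose Gramian forms are at most \<open>l * T i ^ (2 * d + 1)\<close>; a
  subsequence converges to some \<open>u\<close>. The moment bound first shows that \<open>u\<close>
  is unobservable, then contradicts \<open>less\<close> at \<open>u\<close>.\<close>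

lemma lambda_min_gramian_lower:
  fixes A X :: "real^'n^'n"
  assumes X: "psd X" and l: "0 \<le> l"
    and less: "\<And>v. v \<in> unobservable d A X \<Longrightarrow> l < monic_inf d / (fact d)\<^sup>2 * top_form d A X v"
  shows "eventually (\<lambda>T. l * T ^ (2 * d + 1) \<le> lambda_min (gramian A T X)) (at_right 0)"
proof (rule ccontr)
  define M where "M = transpose A"
  have sym: "transpose X = X" using X by (simp add: psd_def)
  assume neg: "\<not> ?thesis"
  have "\<exists>T v. 0 < T \<and> T < 1 / real (Suc i) \<and> norm v = 1 \<and> v \<bullet> (gramian A T X *v v) \<le> l * T ^ (2 * d + 1)" for i
  proof -
    obtain T where "0 < T" "T < 1 / real (Suc i)" "lambda_min (gramian A T X) \<le> l * T ^ (2 * d + 1)"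
      using neg unfolding eventually_at_right_field
      by (metis less_imp_le not_le of_nat_0_less_iff zero_less_Suc zero_less_divide_1_iff)
    then show ?thesis using lambda_min_Rayleigh(1)[OF symmetric_gramian[OF sym], of A T] by metis
  qed
  then obtain T0 v0 where Tv: "\<And>i. 0 < T0 i" "\<And>i. T0 i < 1 / real (Suc i)" "\<And>i. norm (v0 i) = 1"
    "\<And>i. v0 i \<bullet> (gramian A (T0 i) X *v v0 i) \<le> l * T0 i ^ (2 * d + 1)" by metis
  have "compact (sphere (0::real^'n) 1)" by simp
  then obtain u r where u: "u \<in> sphere 0 1" and r: "strict_mono r" and lim: "(v0 \<circ> r) \<longlonglongrightarrow> u"
    using Tv(3) unfolding compact_def by (metis mem_sphere_0)
  define T where "T = T0 \<circ> r"
  define v where "v = v0 \<circ> r"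
  have T: "0 < T i" "T i \<le> 1" for i
  proof -
    show "0 < T i" using Tv(1) by (simp add: T_def)
    have "1 / real (Suc (r i)) \<le> 1" by simp
    then show "T i \<le> 1" using Tv(2)[of "r i"] unfolding T_def by (metis comp_apply less_imp_le order_trans)
  qed
  have v: "norm (v i) = 1" "v i \<bullet> (gramian A (T i) X *v v i) \<le> l * T i ^ (2 * d + 1)" for i
    using Tv(3,4) by (auto simp: v_def T_def)
  have vlim: "v \<longlonglongrightarrow> u" using lim by (simp add: v_def)
  have "T0 \<longlonglongrightarrow> 0"
  proof (rule tendsto_sandwich[of "\<lambda>_. 0" _ _ "\<lambda>i. 1 / real (Suc i)"])
    show "(\<lambda>i. 1 / real (Suc i)) \<longlonglongrightarrow> 0" by (rule LIMSEQ_Suc[OF lim_1_over_n])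
  qed (use Tv(1,2) in \<open>auto intro!: always_eventually less_imp_le simp del: of_nat_Suc\<close>)
  then have Tlim: "T \<longlonglongrightarrow> 0" unfolding T_def using r by (rule LIMSEQ_subseq_LIMSEQ)
  have Mlim: "(\<lambda>i. X *v (matrix_power M q *v v i)) \<longlonglongrightarrow> X *v (matrix_power M q *v u)" for q
    by (intro bounded_linear.tendsto[OF matrix_vector_mul_bounded_linear] vlim)
  obtain C where C: "0 \<le> C" "\<And>T v a \<delta>. 0 < T \<Longrightarrow> T \<le> 1 \<Longrightarrow> norm v = 1 \<Longrightarrow> 0 < \<delta> \<Longrightarrow>
    T * hilbert_form d (\<lambda>q. (a \<bullet> (X *v (matrix_power M q *v v))) / fact q * T ^ q)
    \<le> (1 + \<delta>) * (a \<bullet> (X *v a)) * (v \<bullet> (gramian A T X *v v)) + (1 + 1 / \<delta>) * C * (norm a)\<^sup>2 * T ^ (2 * d + 3)"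
    using gramian_moment_bound[OF X, where A=A and d=d] unfolding M_def by blast
  have bound: "hilbert_form d (\<lambda>q. (a \<bullet> (X *v (matrix_power M q *v v i))) / fact q * T i ^ q)
      \<le> ((1 + \<delta>) * (a \<bullet> (X *v a)) * l + (1 + 1 / \<delta>) * C * (norm a)\<^sup>2 * (T i)\<^sup>2) * (T i ^ d)\<^sup>2"
    (is "?H \<le> ?B * _") if \<delta>: "0 < \<delta>" for a i \<delta>
  proof -
    have nn: "0 \<le> (1 + \<delta>) * (a \<bullet> (X *v a))" using X \<delta> by (simp add: psd_def)
    have "T i * ?H \<le> (1 + \<delta>) * (a \<bullet> (X *v a)) * (l * T i ^ (2 * d + 1))
        + (1 + 1 / \<delta>) * C * (norm a)\<^sup>2 * T i ^ (2 * d + 3)"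
      using C(2)[OF T v(1)[of i] \<delta>, of i a] mult_left_mono[OF v(2)[of i] nn] by linarith
    also have "T i ^ (2 * d + 3) = T i * (T i)\<^sup>2 * (T i ^ d)\<^sup>2"
      by (simp add: power_add mult_2 power2_eq_square numeral_3_eq_3)
    also have "T i ^ (2 * d + 1) = T i * (T i ^ d)\<^sup>2"
      by (simp add: power_mult[symmetric] mult.commute)
    finally have "T i * ?H \<le> T i * (?B * (T i ^ d)\<^sup>2)"
      by (simp only: distrib_left distrib_right mult_ac)
    then show ?thesis using T(1)[of i] by simp
  qed
  \<comment> \<open>Take \<open>a = b i = X *v (M^q v i)\<close>, so that the coefficient of index
    \<open>q\<close> is the squared norm of \<open>b i\<close> times
    \<open>T i ^ q / fact q\<close>. The form is of order \<open>T i ^ (2 * d)\<close>; dividing by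
    \<open>T i ^ (2 * q)\<close> leaves a factor \<open>(T i)^2\<close> since
    \<open>q < d\<close>.\<close>
  have "X *v (matrix_power M q *v u) = 0" if q: "q < d" for q
  proof -
    obtain C2 where C2: "0 < C2" "\<And>c q. q \<le> d \<Longrightarrow> (c q)\<^sup>2 \<le> C2 * hilbert_form d c"
      using hilbert_form_coefficient_bound[of d] by blast
    define b where "b i = X *v (matrix_power M q *v v i)" for i
    have blim: "b \<longlonglongrightarrow> X *v (matrix_power M q *v u)"
      unfolding b_def by (rule Mlim)
    have "((b i \<bullet> b i) / fact q)\<^sup>2 \<le> C2 * ((2 * (b i \<bullet> (X *v b i)) * l + 2 * C * (norm (b i))\<^sup>2 * (T i)\<^sup>2) * (T i)\<^sup>2)"
      (is "_ \<le> C2 * (?B * _)") for i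
    proof -
      have B: "0 \<le> ?B" using X C(1) l by (simp add: psd_def)
      have "T i ^ (d - q) \<le> T i"
        using power_decreasing[of 1 "d - q" "T i"] T[of i] q by simp
      then have "T i ^ d \<le> T i ^ q * T i"
        using q T(1)[of i] power_add[of "T i" q "d - q"] by simp
      then have Td: "(T i ^ d)\<^sup>2 \<le> (T i ^ q * T i)\<^sup>2"
        using T(1)[of i] by (intro power_mono) (auto intro: less_imp_le)
      have "((b i \<bullet> b i) / fact q * T i ^ q)\<^sup>2
          \<le> C2 * hilbert_form d (\<lambda>q. (b i \<bullet> (X *v (matrix_power M q *v v i))) / fact q * T i ^ q)"
        using C2(2)[of q "\<lambda>q. (b i \<bullet> (X *v (matrix_power M q *v v i))) / fact q * T i ^ q"] q
        by (simp add: b_def)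
      also have "\<dots> \<le> C2 * (?B * (T i ^ d)\<^sup>2)"
        using bound[of 1 "b i" i] C2(1) by (intro mult_left_mono) auto
      also have "\<dots> \<le> C2 * (?B * (T i ^ q * T i)\<^sup>2)"
        using C2(1) B Td by (intro mult_left_mono) auto
      finally have "(T i ^ q)\<^sup>2 * ((b i \<bullet> b i) / fact q)\<^sup>2 \<le> (T i ^ q)\<^sup>2 * (C2 * (?B * (T i)\<^sup>2))"
        by (simp only: power_mult_distrib mult_ac)
      then show ?thesis using T(1)[of i] by (simp only: mult_le_cancel_left_pos zero_less_power)
    qed
    moreover have "(\<lambda>i. ((b i \<bullet> b i) / fact q)\<^sup>2) \<longlonglongrightarrow>
        (((X *v (matrix_power M q *v u)) \<bullet> (X *v (matrix_power M q *v u))) / fact q)\<^sup>2"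
      by (intro tendsto_intros blim) simp
    moreover have "(\<lambda>i. C2 * ((2 * (b i \<bullet> (X *v b i)) * l + 2 * C * (norm (b i))\<^sup>2 * (T i)\<^sup>2) * (T i)\<^sup>2)) \<longlonglongrightarrow>
        C2 * ((2 * ((X *v (matrix_power M q *v u)) \<bullet> (X *v (X *v (matrix_power M q *v u)))) * l
          + 2 * C * (norm (X *v (matrix_power M q *v u)))\<^sup>2 * 0\<^sup>2) * 0\<^sup>2)"
      by (intro tendsto_intros blim Tlim bounded_linear.tendsto[OF matrix_vector_mul_bounded_linear])
    ultimately have "(((X *v (matrix_power M q *v u)) \<bullet> (X *v (matrix_power M q *v u))) / fact q)\<^sup>2 \<le> 0"
      using LIMSEQ_le by fastforce
    then show ?thesis by simp
  qed
  then have "u \<in> unobservable d A X" using u by (simp add: unobservable_def M_def)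
  \<comment> \<open>Now \<open>a = z\<close>, and \<open>monic_inf_le\<close> retains only the top
    coefficient, whose normalised limit is \<open>y / fact d\<close>.\<close>
  define z where "z = matrix_power M d *v u"
  define y where "y = z \<bullet> (X *v z)"
  have less': "l < monic_inf d / (fact d)\<^sup>2 * y"
    using less[OF \<open>u \<in> unobservable d A X\<close>] by (simp add: y_def z_def M_def)
  then have "0 < monic_inf d / (fact d)\<^sup>2 * y" using l by linarith
  then have y: "0 < y"
    using monic_inf_pos[of d] by (auto simp: zero_less_mult_iff zero_less_divide_iff)
  define e where "e = monic_inf d / (fact d)\<^sup>2 * y - l"
  have e: "0 < e" using less' by (simp add: e_def)
  \<comment> \<open>Chosen so that \<open>\<delta> * l < e\<close>; the summand 1 keeps the
    denominator positive when \<open>l = 0\<close>.\<close>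
  define \<delta> where "\<delta> = e / (2 * l + 1)"
  have \<delta>: "0 < \<delta>" using e l by (simp add: \<delta>_def)
  have "monic_inf d * ((z \<bullet> (X *v (matrix_power M d *v v i))) / fact d)\<^sup>2
      \<le> (1 + \<delta>) * y * l + (1 + 1 / \<delta>) * C * (norm z)\<^sup>2 * (T i)\<^sup>2" (is "?L \<le> ?R") for i
  proof -
    have "monic_inf d * ((z \<bullet> (X *v (matrix_power M d *v v i))) / fact d * T i ^ d)\<^sup>2 \<le> ?R * (T i ^ d)\<^sup>2"
      using monic_inf_le[of d "\<lambda>q. (z \<bullet> (X *v (matrix_power M q *v v i))) / fact q * T i ^ q"]
        bound[OF \<delta>, of z i] by (simp add: y_def)
    then have "?L * (T i ^ d)\<^sup>2 \<le> ?R * (T i ^ d)\<^sup>2"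
      by (simp only: power_mult_distrib mult_ac)
    then show ?thesis using T(1)[of i] by (simp only: mult_le_cancel_right_pos zero_less_power)
  qed
  moreover have "(\<lambda>i. monic_inf d * ((z \<bullet> (X *v (matrix_power M d *v v i))) / fact d)\<^sup>2) \<longlonglongrightarrow>
      monic_inf d * ((z \<bullet> (X *v (matrix_power M d *v u))) / fact d)\<^sup>2"
    by (intro tendsto_intros Mlim) simp
  moreover have "(\<lambda>i. (1 + \<delta>) * y * l + (1 + 1 / \<delta>) * C * (norm z)\<^sup>2 * (T i)\<^sup>2) \<longlonglongrightarrow>
      (1 + \<delta>) * y * l + (1 + 1 / \<delta>) * C * (norm z)\<^sup>2 * 0\<^sup>2"
    by (intro tendsto_intros Tlim)
  ultimately have "monic_inf d * (y / fact d)\<^sup>2 \<le> (1 + \<delta>) * y * l + (1 + 1 / \<delta>) * C * (norm z)\<^sup>2 * 0\<^sup>2"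
    unfolding y_def z_def using LIMSEQ_le by blast
  then have "y * (monic_inf d / (fact d)\<^sup>2 * y) \<le> y * ((1 + \<delta>) * l)"
    by (simp add: power_divide power2_eq_square mult_ac)
  then have "monic_inf d / (fact d)\<^sup>2 * y \<le> (1 + \<delta>) * l" using y by (simp only: mult_le_cancel_left_pos)
  then have "e \<le> \<delta> * l" by (simp add: e_def algebra_simps)
  also have "\<delta> * l = e * (l / (2 * l + 1))" by (simp add: \<delta>_def)
  also have "\<dots> < e * 1" using e l by (intro mult_strict_left_mono) auto
  finally show False by simp
qed

text \<open>Along a vector unobservable to order \<open>j\<close>, the form sees only the Taylor
  tail, bounded by a multiple of \<open>x^j / fact j\<close>. The vector may change with
  \<open>j\<close>; the bound on the eigenvalue tends to 0.\<close>

lemma lambda_min_gramian_zero: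
  fixes A X :: "real^'n^'n"
  assumes X: "psd X" and T: "0 \<le> T" and ne: "\<And>j. unobservable j A X \<noteq> {}"
  shows "lambda_min (gramian A T X) = 0"
proof -
  define M where "M = transpose A"
  have sym: "transpose X = X" using X by (simp add: psd_def)
  define x where "x = T * norm M"
  have "lambda_min (gramian A T X) \<le> T * (norm X * (x ^ j / fact j * exp x)\<^sup>2)" for j
  proof -
    obtain v where v: "norm v = 1" "\<And>q. q < j \<Longrightarrow> X *v (matrix_power M q *v v) = 0"
      using ne[of j] by (auto simp: unobservable_def M_def)
    have form: "flow M t v \<bullet> (X *v flow M t v) \<le> norm X * (x ^ j / fact j * exp x)\<^sup>2" if t: "t \<in> {0..T}" for t
    proof -
      define r where "r = flow M t v - (\<Sum>q<j. (t ^ q / fact q) *\<^sub>R (matrix_power M q *v v))"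
      have Xr: "X *v flow M t v = X *v r"
        using v(2) by (simp add: r_def matrix_vector_mult_diff_distrib linear_sum[OF matrix_vector_mul_linear]
            matrix_vector_mult_scaleR)
      have "norm r \<le> (\<bar>t\<bar> * norm M) ^ j / fact j * exp (\<bar>t\<bar> * norm M) * norm v"
        unfolding r_def by (rule flow_Taylor)
      also have "\<dots> \<le> x ^ j / fact j * exp x * 1"
        unfolding x_def using t v(1) T
        by (intro mult_mono divide_right_mono power_mono) (auto intro: mult_right_mono)
      finally have r: "norm r \<le> x ^ j / fact j * exp x" by simp
      have "flow M t v \<bullet> (X *v flow M t v) = r \<bullet> (X *v r)"
        using Xr by (metis symmetric_inner_commute[OF sym])
      also have "\<dots> \<le> norm X * norm r * norm r"
        using inner_matrix_le[of r X r] by linarith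
      also have "\<dots> = norm X * (norm r)\<^sup>2" by (simp add: power2_eq_square)
      also have "\<dots> \<le> norm X * (x ^ j / fact j * exp x)\<^sup>2"
        by (intro mult_left_mono power_mono r) auto
      finally show ?thesis .
    qed
    have "lambda_min (gramian A T X) \<le> integral {0..T} (\<lambda>t. flow M t v \<bullet> (X *v flow M t v))"
      using lambda_min_gramian_le[OF sym, of A T v] v(1) by (simp add: M_def)
    also have "\<dots> \<le> integral {0..T} (\<lambda>t. norm X * (x ^ j / fact j * exp x)\<^sup>2)"
      using form by (intro integral_le integrable_continuous_real continuous_on_flow_form continuous_intros) auto
    finally show ?thesis using T by (simp add: mult.left_commute)
  qed
  moreover have "(\<lambda>j. T * (norm X * (x ^ j / fact j * exp x)\<^sup>2)) \<longlonglongrightarrow> T * (norm X * (0 * exp x)\<^sup>2)"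
    using summable_LIMSEQ_zero[OF summable_exp[of x]]
    by (intro tendsto_intros) (simp add: divide_inverse mult.commute)
  ultimately have "lambda_min (gramian A T X) \<le> 0"
    using LIMSEQ_le_const by fastforce
  then show ?thesis using lambda_min_gramian_nonneg[OF X, of A T] by linarith
qed

section \<open>The leading coefficient and the short-time limit\<close>

definition top_gap :: "nat \<Rightarrow> real^'n^'n \<Rightarrow> real^'n^'n \<Rightarrow> real" where
  "top_gap d A X = (INF v\<in>unobservable d A X. top_form d A X v)"

text \<open>With \<open>d = s - 1\<close> this is the constant \<open>c_k(A)\<close>. The factor
  \<open>1 / (fact d)^2\<close> comes from the Taylor coefficient of order \<open>d\<close>, and
  \<open>monic_inf d\<close> from optimising over perturbations of the test vector.\<close>

definition leading_coeff :: "nat \<Rightarrow> nat \<Rightarrow> real^'n^'n \<Rightarrow> real" where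
  "leading_coeff k d A = monic_inf d / (fact d)\<^sup>2 * (SUP X\<in>admissible k. top_gap d A X)"

lemma top_gap_le: "psd X \<Longrightarrow> v \<in> unobservable d A X \<Longrightarrow> top_gap d A X \<le> top_form d A X v"
  unfolding top_gap_def by (intro cINF_lower bdd_belowI[of _ 0]) (auto simp: psd_def)

lemma top_gap_nonneg: "psd X \<Longrightarrow> unobservable d A X \<noteq> {} \<Longrightarrow> 0 \<le> top_gap d A X"
  unfolding top_gap_def by (intro cINF_greatest) (auto simp: psd_def)

text \<open>Makes the supremum in \<open>leading_coeff\<close> a genuine one: the value of the form
  at any single unobservable vector bounds the infimum, uniformly in \<open>X\<close>.\<close>

lemma bdd_above_top_gap:
  fixes A :: "real^'n^'n"
  assumes "\<And>X. X \<in> admissible k \<Longrightarrow> unobservable d A X \<noteq> {}"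
  shows "bdd_above (top_gap d A ` admissible k)"
proof (rule bdd_aboveI2)
  fix X :: "real^'n^'n" assume X: "X \<in> admissible k"
  then have psd: "psd X" "trace X = 1" by (auto simp: admissible_def)
  obtain v where v: "v \<in> unobservable d A X" using assms[OF X] by blast
  let ?z = "matrix_power (transpose A) d *v v"
  have z: "norm ?z \<le> norm (transpose A) ^ d"
    using norm_matrix_power_vector_le[of "transpose A" d v] v by (simp add: unobservable_def)
  have "top_gap d A X \<le> top_form d A X v" by (rule top_gap_le[OF psd(1) v])
  also have "\<dots> \<le> norm X * norm ?z * norm ?z" using inner_matrix_le[of ?z X ?z] by linarith
  also have "\<dots> \<le> (real CARD('n))\<^sup>2 * norm (transpose A) ^ d * norm (transpose A) ^ d"
    by (intro mult_mono z psd_norm_le psd) auto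
  finally show "top_gap d A X \<le> \<dots>" .
qed

text \<open>From below, fix one nearly optimal \<open>X\<close> and apply
  \<open>lambda_min_gramian_lower\<close>. From above, fix one nearly optimal monic polynomial and
  apply \<open>lambda_min_gramian_upper\<close>, whose constant serves all \<open>X\<close> at
  once.\<close>

lemma gamma_k_asymptotics:
  fixes A :: "real^'n^'n"
  assumes adm: "admissible k \<noteq> ({} :: (real^'n^'n) set)"
    and ne: "\<And>X. X \<in> admissible k \<Longrightarrow> unobservable d A X \<noteq> {}"
  shows "((\<lambda>T. gamma_k k A T / T ^ (2 * d + 1)) \<longlongrightarrow> leading_coeff k d A) (at_right 0)"
proof (rule order_tendstoI)
  define S where "S = (SUP X\<in>admissible k. top_gap d A X)"
  have bdd: "bdd_above (top_gap d A ` admissible k)"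
    using ne by (rule bdd_above_top_gap)
  have gapS: "top_gap d A X \<le> S" if "X \<in> admissible k" for X
    unfolding S_def using that bdd by (intro cSUP_upper)
  have S: "0 \<le> S"
  proof -
    obtain X :: "real^'n^'n" where X: "X \<in> admissible k" using adm by blast
    then have "0 \<le> top_gap d A X" by (intro top_gap_nonneg ne) (simp_all add: admissible_def)
    then show ?thesis using gapS[OF X] by linarith
  qed
  have pos: "eventually (\<lambda>T::real. 0 < T) (at_right 0)"
    by (simp add: eventually_at_right_less)
  fix y
  {
    assume y: "y < leading_coeff k d A"
    show "eventually (\<lambda>T. y < gamma_k k A T / T ^ (2 * d + 1)) (at_right 0)"
    \<comment> \<open>The lower bound lemma requires a nonnegative level; below 0 the claim follows
      from \<open>gamma_k\<close> being nonnegative.\<close>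
    proof (cases "y < 0")
      case True
      show ?thesis
        using pos
      proof eventually_elim
        case (elim T)
        have "0 \<le> gamma_k k A T"
          using gamma_k_max(1)[OF adm, of A T] lambda_min_gramian_nonneg by (auto simp: admissible_def)
        then have "0 \<le> gamma_k k A T / T ^ (2 * d + 1)" using elim by simp
        then show ?case using True by linarith
      qed
    next
      case False
      obtain l where l: "y < l" "l < leading_coeff k d A" using dense[OF y] by blast
      define m where "m = monic_inf d / (fact d)\<^sup>2"
      have m: "0 < m" using monic_inf_pos by (simp add: m_def)
      have "l / m < S" using l(2) m by (simp add: leading_coeff_def m_def S_def field_simps)
      then obtain X where X: "X \<in> admissible k" "l / m < top_gap d A X"
        unfolding S_def less_cSUP_iff[OF adm bdd] by blast
      then have psd: "psd X" by (simp add: admissible_def)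
      have "l < m * top_form d A X v" if "v \<in> unobservable d A X" for v
      proof -
        have "l / m < top_form d A X v" using X(2) top_gap_le[OF psd that] by linarith
        then show ?thesis using m by (simp add: divide_less_eq mult.commute)
      qed
      then have "eventually (\<lambda>T. l * T ^ (2 * d + 1) \<le> lambda_min (gramian A T X)) (at_right 0)"
        using False l(1) unfolding m_def by (intro lambda_min_gramian_lower[OF psd]) auto
      with pos show ?thesis
      proof eventually_elim
        case (elim T)
        have "l \<le> gamma_k k A T / T ^ (2 * d + 1)"
          using elim gamma_k_max(2)[OF adm X(1), of A T] by (simp add: pos_le_divide_eq)
        then show ?case using l(1) by linarith
      qed
    qed
  next
    assume y: "leading_coeff k d A < y"
    \<comment> \<open>The slack \<open>e\<close> in the polynomial is fixed before \<open>T\<close>,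
      so small that the limiting bound still lies below \<open>y\<close>.\<close>
    have "((\<lambda>e. (monic_inf d + e) * S / (fact d)\<^sup>2) \<longlongrightarrow> (monic_inf d + 0) * S / (fact d)\<^sup>2) (at_right 0)"
      by (intro tendsto_intros) auto
    moreover have "(monic_inf d + 0) * S / (fact d)\<^sup>2 < y" using y by (simp add: leading_coeff_def S_def)
    ultimately have "eventually (\<lambda>e. (monic_inf d + e) * S / (fact d)\<^sup>2 < y) (at_right 0)"
      by (rule order_tendstoD(2))
    then have "eventually (\<lambda>e. 0 < e \<and> (monic_inf d + e) * S / (fact d)\<^sup>2 < y) (at_right 0)"
      using pos by eventually_elim simp
    then obtain e where e: "0 < e" "(monic_inf d + e) * S / (fact d)\<^sup>2 < y"
      using eventually_happens' trivial_limit_at_right_real by blast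
    obtain c where c: "c d = 1" "hilbert_form d c < monic_inf d + e"
      using monic_inf_approx[OF e(1)] .
    define h where "h = hilbert_form d c"
    have h: "0 < h" using monic_inf_le[of d c] monic_inf_pos[of d] c(1) by (simp add: h_def)
    have "h * S / (fact d)\<^sup>2 \<le> (monic_inf d + e) * S / (fact d)\<^sup>2"
      using c(2) S by (intro divide_right_mono mult_right_mono) (auto simp: h_def)
    with e(2) have hy: "h * S / (fact d)\<^sup>2 < y" by linarith
    obtain C where C: "0 \<le> C" "\<And>T X v. 0 < T \<Longrightarrow> T \<le> 1 \<Longrightarrow> psd X \<Longrightarrow> trace X = 1 \<Longrightarrow> norm v = 1 \<Longrightarrow>
      (\<And>q. q < d \<Longrightarrow> X *v (matrix_power (transpose A) q *v v) = 0) \<Longrightarrow> C * T \<le> fact d \<Longrightarrow>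
      lambda_min (gramian A T X) * (fact d - C * T)\<^sup>2 \<le> T ^ (2 * d + 1) * (h * top_form d A X v + C * T)"
      using lambda_min_gramian_upper[where c=c and d=d and A=A, OF c(1)] unfolding h_def by blast
    have "((\<lambda>T. (h * S + C * T) / (fact d - C * T)\<^sup>2) \<longlongrightarrow> (h * S + C * 0) / (fact d - C * 0)\<^sup>2) (at_right 0)"
      by (intro tendsto_intros) auto
    then have 1: "eventually (\<lambda>T. (h * S + C * T) / (fact d - C * T)\<^sup>2 < y) (at_right 0)"
      using hy by (intro order_tendstoD(2)) auto
    have "((\<lambda>T. C * T) \<longlongrightarrow> C * 0) (at_right 0)"
      by (intro tendsto_intros)
    then have 2: "eventually (\<lambda>T. C * T < fact d) (at_right 0)"
      by (intro order_tendstoD(2)[of _ "C * 0"]) auto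
    have 3: "eventually (\<lambda>T::real. T < 1) (at_right 0)"
      by (rule eventually_at_right_real[THEN eventually_mono, of 0 1]) auto
    show "eventually (\<lambda>T. gamma_k k A T / T ^ (2 * d + 1) < y) (at_right 0)"
      using pos 1 2 3
    proof eventually_elim
      case (elim T)
      \<comment> \<open>The maximiser varies with \<open>T\<close>, while \<open>h\<close> and
        \<open>C\<close> are already fixed.\<close>
      obtain X where X: "X \<in> admissible k" "gamma_k k A T = lambda_min (gramian A T X)"
        using gamma_k_max(1)[OF adm, of A T] by blast
      then have psd: "psd X" "trace X = 1" by (auto simp: admissible_def)
      define g where "g = gamma_k k A T / T ^ (2 * d + 1)"
      have Tp: "0 < T ^ (2 * d + 1)" using elim by simp
      \<comment> \<open>The upper bound holds at every unobservable \<open>v\<close>; solved for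
        \<open>top_form\<close> it passes to the infimum.\<close>
      have "(g * (fact d - C * T)\<^sup>2 - C * T) / h \<le> top_gap d A X"
        unfolding top_gap_def
      proof (rule cINF_greatest[OF ne[OF X(1)]])
        fix v assume v: "v \<in> unobservable d A X"
        have "lambda_min (gramian A T X) * (fact d - C * T)\<^sup>2 \<le> T ^ (2 * d + 1) * (h * top_form d A X v + C * T)"
          using elim v by (intro C(2) psd) (auto simp: unobservable_def)
        then have "g * (fact d - C * T)\<^sup>2 \<le> h * top_form d A X v + C * T"
          unfolding g_def X(2) using Tp by (simp add: pos_divide_le_eq mult.commute)
        then show "(g * (fact d - C * T)\<^sup>2 - C * T) / h \<le> top_form d A X v"
          using h by (simp add: pos_divide_le_eq mult.commute)
      qed
      also have "\<dots> \<le> S" by (rule gapS[OF X(1)])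
      finally have "g * (fact d - C * T)\<^sup>2 \<le> h * S + C * T"
        using h by (simp add: pos_divide_le_eq mult.commute)
      then have "g \<le> (h * S + C * T) / (fact d - C * T)\<^sup>2"
        using elim by (subst pos_le_divide_eq) auto
      then show ?case using elim by (simp add: g_def)
    qed
  }
qed

text \<open>By compactness \<open>top_form\<close> attains its minimum over the unobservable vectors
  of order \<open>d\<close>. A zero minimum would make the minimiser unobservable to order
  \<open>d + 1\<close>, against \<open>full\<close>.\<close>

lemma leading_coeff_pos:
  fixes A :: "real^'n^'n"
  assumes ne: "\<And>X. X \<in> admissible k \<Longrightarrow> unobservable d A X \<noteq> {}"
    and X: "X \<in> admissible k" and full: "unobservable (Suc d) A X = {}"
  shows "0 < leading_coeff k d A"
proof -
  have psd: "psd X" using X by (simp add: admissible_def)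
  have "compact (unobservable d A X)"
  proof -
    have "unobservable d A X = sphere 0 1 \<inter> (\<Inter>q\<in>{..<d}. {v. X *v (matrix_power (transpose A) q *v v) = 0})"
      by (auto simp: unobservable_def)
    moreover have "closed (\<Inter>q\<in>{..<d}. {v. X *v (matrix_power (transpose A) q *v v) = 0})"
      by (intro closed_INT ballI closed_Collect_eq continuous_on_const
          bounded_linear.continuous_on[OF matrix_vector_mul_bounded_linear] continuous_on_id)
    ultimately show ?thesis by (simp add: compact_Int_closed)
  qed
  moreover have "continuous_on (unobservable d A X) (top_form d A X)"
    by (intro continuous_on_inner bounded_linear.continuous_on[OF matrix_vector_mul_bounded_linear] continuous_on_id)
  ultimately obtain v where v: "v \<in> unobservable d A X"
    "\<And>w. w \<in> unobservable d A X \<Longrightarrow> top_form d A X v \<le> top_form d A X w"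
    using continuous_attains_inf[OF _ ne[OF X], of "top_form d A X"] by blast
  have "top_form d A X v \<noteq> 0"
  proof
    assume "top_form d A X v = 0"
    then have "X *v (matrix_power (transpose A) d *v v) = 0" by (rule psd_kernel[OF psd])
    then have "v \<in> unobservable (Suc d) A X"
      using v(1) by (auto simp: unobservable_def less_Suc_eq)
    then show False using full by simp
  qed
  moreover have "0 \<le> top_form d A X v" using psd by (simp add: psd_def)
  moreover have "top_form d A X v \<le> top_gap d A X"
    unfolding top_gap_def using v ne[OF X] by (intro cINF_greatest) auto
  moreover have "top_gap d A X \<le> (SUP X\<in>admissible k. top_gap d A X)"
    using X by (intro cSUP_upper bdd_above_top_gap ne)
  ultimately have "0 < (SUP X\<in>admissible k. top_gap d A X)" by linarith
  then show ?thesis using monic_inf_pos[of d] by (simp add: leading_coeff_def)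
qed

section \<open>Krylov spaces\<close>

lemma krylov_0: "krylov 0 A X = {0}"
  by (simp add: krylov_def set_zero)

lemma krylov_Suc: "krylov (Suc j) A X = krylov j A X + range (\<lambda>v. matrix_power A j *v (X *v v))"
  by (simp add: krylov_def image_image)

lemma range_term_subspace: "subspace (range (\<lambda>v. matrix_power A j *v (X *v v)))"
  using linear_subspace_image[OF linear_compose[OF matrix_vector_mul_linear[of X] matrix_vector_mul_linear[of "matrix_power A j"]] subspace_UNIV]
  by (simp add: o_def)

lemma set_plus_eq_sums: "S + T = {x + y |x y. x \<in> S \<and> y \<in> T}"
  by (auto simp: set_plus_def)

lemma subspace_krylov: "subspace (krylov j A X)"
proof (induction j)
  case (Suc j)
  then show ?case
    unfolding krylov_Suc set_plus_eq_sums by (intro subspace_sums range_term_subspace)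
qed (simp add: krylov_0)

lemma krylov_term: "q < j \<Longrightarrow> matrix_power A q *v (X *v v) \<in> krylov j A X"
proof (induction j)
  case (Suc j)
  show ?case
  proof (cases "q = j")
    case True
    have "0 + matrix_power A q *v (X *v v) \<in> krylov (Suc j) A X"
      unfolding krylov_Suc True by (intro set_plus_intro subspace_0 subspace_krylov) auto
    then show ?thesis by simp
  next
    case False
    have "matrix_power A q *v (X *v v) + 0 \<in> krylov (Suc j) A X"
      unfolding krylov_Suc using False Suc
      by (intro set_plus_intro subspace_0 range_term_subspace) auto
    then show ?thesis by simp
  qed
qed simp

text \<open>Each of the \<open>j\<close> summands is a linear image of the range of
  \<open>X\<close>.\<close>

lemma dim_krylov_le: "dim (krylov j A X) \<le> j * rank X"
proof (induction j)
  case (Suc j)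
  let ?W = "range (\<lambda>v. matrix_power A j *v (X *v v))"
  have "?W = (*v) (matrix_power A j) ` range (\<lambda>v. X *v v)" by auto
  then have "dim ?W \<le> rank X"
    unfolding rank_dim_range by (metis dim_image_le matrix_vector_mul_linear)
  moreover have "dim (krylov (Suc j) A X) \<le> dim (krylov j A X) + dim ?W"
    unfolding krylov_Suc set_plus_eq_sums
    using dim_sums_Int[OF subspace_krylov range_term_subspace, of j A X A j X] by linarith
  ultimately show ?case using Suc by simp
qed (simp add: krylov_0)

lemma krylov_orthogonal:
  assumes sym: "transpose X = X" and v: "\<And>q. q < j \<Longrightarrow> X *v (matrix_power (transpose A) q *v v) = 0"
    and x: "x \<in> krylov j A X"
  shows "v \<bullet> x = 0"
  using v x
proof (induction j arbitrary: x)
  case (Suc j)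
  then obtain y w where x: "x = y + matrix_power A j *v (X *v w)" and y: "y \<in> krylov j A X"
    by (auto simp: krylov_Suc set_plus_def)
  have "v \<bullet> (matrix_power A j *v (X *v w)) = (X *v (matrix_power (transpose A) j *v v)) \<bullet> w"
    by (simp add: inner_matrix_right transpose_matrix_power sym)
  then show ?case using Suc.IH[OF Suc.prems(1) y] Suc.prems(1)[of j] by (simp add: x inner_add_right)
qed (simp add: krylov_0)

text \<open>Duality: the orthogonal complement of the Krylov space is the unobservable subspace. For
  a normal \<open>x\<close> to a proper Krylov space and \<open>w = X *v (M^q x)\<close>, with
  \<open>M = transpose A\<close>, the squared norm of \<open>w\<close> is \<open>x\<close> paired
  with \<open>A^q X w\<close>, a Krylov vector, hence 0.\<close>

lemma krylov_UNIV_iff: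
  fixes A :: "real^'n^'n"
  assumes sym: "transpose X = X"
  shows "krylov j A X = UNIV \<longleftrightarrow> unobservable j A X = {}"
proof
  assume full: "krylov j A X = UNIV"
  have False if "v \<in> unobservable j A X" for v
    using that krylov_orthogonal[OF sym, of j A v v] full by (auto simp: unobservable_def)
  then show "unobservable j A X = {}" by blast
next
  assume empty: "unobservable j A X = {}"
  show "krylov j A X = UNIV"
  proof (rule ccontr)
    assume "krylov j A X \<noteq> UNIV"
    then have "dim (krylov j A X) < DIM(real^'n)"
      by (metis dim_eq_full dim_subset_UNIV le_neq_implies_less span_eq_iff subspace_krylov)
    then obtain x where x: "x \<noteq> 0" "\<And>y. y \<in> span (krylov j A X) \<Longrightarrow> orthogonal x y"
      using orthogonal_to_subspace_exists by blast
    have z: "X *v (matrix_power (transpose A) q *v x) = 0" if "q < j" for q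
    proof -
      let ?w = "X *v (matrix_power (transpose A) q *v x)"
      have "?w \<bullet> ?w = x \<bullet> (matrix_power A q *v (X *v ?w))"
        by (simp add: inner_matrix_right transpose_matrix_power sym)
      also have "\<dots> = 0"
        using x(2)[OF span_base[OF krylov_term[OF that]]] by (simp add: orthogonal_def)
      finally show ?thesis by simp
    qed
    have "x /\<^sub>R norm x \<in> unobservable j A X"
      using x(1) z by (simp add: unobservable_def matrix_vector_mult_scaleR)
    then show False using empty by blast
  qed
qed

lemma admissible_krylov_iff:
  "X \<in> admissible k \<Longrightarrow> krylov j A X = UNIV \<longleftrightarrow> unobservable j A X = {}" for X :: "real^'n^'n"
  by (intro krylov_UNIV_iff) (simp add: admissible_def psd_def)

text \<open>Take the sum of the rank-one matrices of the \<open>c l\<close>, divided by the sum of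
  their squared norms to give trace 1; one nonzero vector makes this possible. The form is a sum of
  squares, so a kernel vector is orthogonal to each \<open>c l\<close>.\<close>

lemma admissible_of_vectors:
  fixes c :: "nat \<Rightarrow> real^'n"
  assumes ne: "l0 < m" "c l0 \<noteq> 0"
  obtains X where "X \<in> admissible m" "\<And>v l. X *v v = 0 \<Longrightarrow> l < m \<Longrightarrow> c l \<bullet> v = 0"
proof -
  define s where "s = (\<Sum>l<m. (norm (c l))\<^sup>2)"
  have "(norm (c l0))\<^sup>2 \<le> s"
    unfolding s_def using ne(1) by (intro member_le_sum) auto
  then have s: "0 < s" using ne(2) by (smt (verit) zero_less_norm_iff zero_less_power)
  define X :: "real^'n^'n" where "X = (\<chi> i j. \<Sum>l<m. c l $ i * c l $ j / s)"
  have X: "X *v v = (\<Sum>l<m. (c l \<bullet> v / s) *\<^sub>R c l)" for v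
    by (simp add: X_def matrix_vector_mult_def vec_eq_iff inner_vec_def sum_distrib_left sum_distrib_right
        sum_divide_distrib mult_ac) (intro allI, rule sum.swap)
  have form: "v \<bullet> (X *v v) = (\<Sum>l<m. (c l \<bullet> v)\<^sup>2 / s)" for v
    by (simp add: X inner_sum_right power2_eq_square inner_commute)
  have "transpose X = X"
    by (simp add: X_def transpose_def mult.commute)
  moreover have "0 \<le> v \<bullet> (X *v v)" for v
    unfolding form using s by (intro sum_nonneg) auto
  moreover have "trace X = 1"
  proof -
    have "trace X = (\<Sum>l<m. \<Sum>i\<in>UNIV. c l $ i * c l $ i / s)"
      unfolding trace_def X_def by (simp add: sum.swap[of _ "{..<m}"])
    also have "\<dots> = (\<Sum>l<m. (norm (c l))\<^sup>2 / s)"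
      by (simp add: power2_norm_eq_inner inner_vec_def sum_divide_distrib)
    also have "\<dots> = 1" using s by (simp add: s_def sum_divide_distrib[symmetric])
    finally show ?thesis .
  qed
  moreover have "rank X \<le> m"
  proof -
    have "range (\<lambda>v. X *v v) \<subseteq> span (c ` {..<m})"
      unfolding X by (intro image_subsetI span_sum span_scale span_base) auto
    then have "rank X \<le> card (c ` {..<m})"
      unfolding rank_dim_range by (intro dim_le_card) auto
    also have "\<dots> \<le> m" using card_image_le[of "{..<m}" c] by simp
    finally show ?thesis .
  qed
  ultimately have "X \<in> admissible m" by (simp add: admissible_def psd_def)
  moreover have "c l \<bullet> v = 0" if "X *v v = 0" "l < m" for v l
  proof -
    have "(\<Sum>l<m. (c l \<bullet> v)\<^sup>2 / s) = 0" using form[of v] that(1) by simp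
    then have "(c l \<bullet> v)\<^sup>2 / s = 0"
      using s that(2) by (subst (asm) sum_nonneg_eq_0_iff) auto
    then show ?thesis using s by simp
  qed
  ultimately show ?thesis using that by blast
qed

lemma admissible_nonempty:
  assumes "1 \<le> k"
  shows "admissible k \<noteq> ({} :: (real^'n^'n) set)"
proof -
  obtain X :: "real^'n^'n" where "X \<in> admissible k"
    using admissible_of_vectors[of 0 k "\<lambda>_. axis undefined 1"] assms
    by (metis axis_eq_0_iff less_eq_Suc_le One_nat_def zero_neq_one)
  then show ?thesis by blast
qed

section \<open>The index \<open>s_k\<close> and its consequences for \<open>gamma_k\<close>\<close>

lemma s_k_le: "1 \<le> j \<Longrightarrow> X \<in> admissible k \<Longrightarrow> krylov j A X = UNIV \<Longrightarrow> s_k k A \<le> enat j"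
  unfolding s_k_def by (intro Inf_lower) auto

lemma s_k_attained:
  assumes "s_k k A = enat s"
  shows "1 \<le> s" and "\<exists>X\<in>admissible k. krylov s A X = UNIV"
proof -
  define S where "S = {enat j | j. 1 \<le> j \<and> (\<exists>X \<in> admissible k. krylov j A X = UNIV)}"
  have Inf: "Inf S = enat s" using assms by (simp add: s_k_def S_def)
  then have "S \<noteq> {}" by (metis Inf_enat_def enat.distinct(1))
  then have "Inf S \<in> S" unfolding Inf_enat_def by (auto intro: LeastI)
  then have "enat s \<in> S" using Inf by simp
  then have "1 \<le> s \<and> (\<exists>X\<in>admissible k. krylov s A X = UNIV)" by (auto simp: S_def)
  then show "1 \<le> s" and "\<exists>X\<in>admissible k. krylov s A X = UNIV" by blast+
qed

text \<open>Minimality of \<open>s_k\<close>, translated by duality into the hypothesis that the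
  asymptotic results require.\<close>

lemma unobservable_below_s_k:
  fixes A :: "real^'n^'n"
  assumes X: "X \<in> admissible k" and j: "enat j < s_k k A"
  shows "unobservable j A X \<noteq> {}"
\<comment> \<open>The definition of \<open>s_k\<close> ranges over \<open>j \<ge> 1\<close>, so
  order 0 is settled directly.\<close>
proof (cases "j = 0")
  case True
  have "axis undefined 1 \<in> unobservable 0 A X" by (simp add: unobservable_def)
  then show ?thesis unfolding True by blast
next
  case False
  have "krylov j A X \<noteq> UNIV"
    using s_k_le[of j X k A] X j False by auto
  then show ?thesis by (simp add: admissible_krylov_iff[OF X])
qed

text \<open>Every order lies below \<open>\<infinity>\<close>, so the maximiser has unobservable
  vectors of all orders.\<close>

lemma gamma_k_zero:
  fixes A :: "real^'n^'n"
  assumes k: "1 \<le> k" and s: "s_k k A = \<infinity>" and T: "0 \<le> T"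
  shows "gamma_k k A T = 0"
proof -
  obtain X where X: "X \<in> admissible k" "gamma_k k A T = lambda_min (gramian A T X)"
    using gamma_k_max(1)[OF admissible_nonempty[OF k], of A T] by blast
  then show ?thesis
    using lambda_min_gramian_zero[of X T A] unobservable_below_s_k[OF X(1), of _ A] s T
    by (simp add: admissible_def)
qed

text \<open>For \<open>d = 0\<close> the gap is the least value of the form of \<open>X\<close> on
  the unit sphere. It is at most every diagonal entry, hence at most their mean
  \<open>1 / n\<close>, and the multiple \<open>I / n\<close> of the identity attains this.\<close>

lemma leading_coeff_rel: "leading_coeff CARD('n) 0 (A :: real^'n^'n) = 1 / real CARD('n)"
proof -
  have gap: "top_gap 0 A X = (INF v\<in>{v. norm v = 1}. v \<bullet> (X *v v))" for X
    by (simp add: top_gap_def unobservable_def)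
  have "(SUP X\<in>admissible CARD('n). top_gap 0 A X) = 1 / real CARD('n)"
  proof (rule cSup_eq_maximum)
    define X :: "real^'n^'n" where "X = (1 / real CARD('n)) *\<^sub>R mat 1"
    have Xv: "X *v v = (1 / real CARD('n)) *\<^sub>R v" for v
      by (simp add: X_def flip: scaleR_matrix_vector_assoc)
    have "transpose X = X" by (simp add: X_def transpose_scalar)
    moreover have "trace X = 1" by (simp add: X_def trace_def mat_def)
    moreover have "rank X \<le> CARD('n)" using rank_bound[of X] by simp
    ultimately have adm: "X \<in> admissible CARD('n)"
      by (simp add: admissible_def psd_def Xv)
    have "(\<lambda>v. v \<bullet> (X *v v)) ` {v. norm v = 1} = {1 / real CARD('n)}"
    proof -
      have "v \<bullet> (X *v v) = 1 / real CARD('n)" if "norm v = 1" for v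
        using that by (simp add: Xv power2_norm_eq_inner[symmetric])
      moreover have "axis undefined 1 \<in> {v :: real^'n. norm v = 1}" by simp
      ultimately show ?thesis by (metis (mono_tags, lifting) image_constant image_cong mem_Collect_eq)
    qed
    then have "top_gap 0 A X = 1 / real CARD('n)" by (simp add: gap)
    then show "1 / real CARD('n) \<in> top_gap 0 A ` admissible CARD('n)"
      using adm by (metis imageI)
  next
    fix y assume "y \<in> top_gap 0 A ` admissible CARD('n)"
    then obtain X where y: "y = top_gap 0 A X" and X: "psd X" "trace X = 1"
      by (auto simp: admissible_def)
    have "axis i 1 \<bullet> (X *v axis i 1) = X $ i $ i" for i
      by (simp add: inner_axis' matrix_vector_mult_basis column_def)
    then have "y \<le> X $ i $ i" for i
      using top_gap_le[OF X(1), of "axis i 1" 0 A] unfolding y by (simp add: unobservable_def)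
    then have "(\<Sum>i\<in>(UNIV::'n set). y) \<le> trace X"
      unfolding trace_def by (intro sum_mono) auto
    then show "y \<le> 1 / real CARD('n)" by (simp add: X(2) pos_le_divide_eq mult.commute)
  qed
  then show ?thesis by (simp add: leading_coeff_def monic_inf_0)
qed

text \<open>The case \<open>d = 0\<close>, \<open>k = n\<close> of the general limit: order 0
  imposes no condition on a unit vector.\<close>

lemma gamma_rel_asymptotics:
  "((\<lambda>T. gamma_rel A T / T) \<longlongrightarrow> 1 / real CARD('n)) (at_right 0)" for A :: "real^'n^'n"
proof -
  have "unobservable 0 A X \<noteq> {}" for X
  proof -
    have "axis undefined 1 \<in> unobservable 0 A X" by (simp add: unobservable_def)
    then show ?thesis by blast
  qed
  then show ?thesis
    using gamma_k_asymptotics[OF admissible_nonempty, of "CARD('n)" 0 A]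
    by (simp add: leading_coeff_rel gamma_rel_def)
qed

text \<open>Spacing \<open>k\<close> vectors of the cyclic orbit at distance
  \<open>J = \<lceil>n / k\<rceil>\<close> lets \<open>J\<close> Krylov steps fill all gaps.
  Conversely, a Krylov space of order \<open>j\<close> has dimension at most
  \<open>j * k\<close>.\<close>

lemma s_k_cyclic:
  fixes A :: "real^'n^'n"
  assumes k: "1 \<le> k" and cyc: "cyclic A"
  shows "s_k k A = enat (nat \<lceil>real CARD('n) / real k\<rceil>)"
proof (rule antisym)
  define m where "m = CARD('n)"
  define J where "J = nat \<lceil>real m / real k\<rceil>"
  have "0 < real m / real k" using k by (simp add: m_def)
  then have J: "1 \<le> J" unfolding J_def by linarith
  have "real m / real k \<le> real J" unfolding J_def by linarith
  then have "real m \<le> real (J * k)" using k by (simp add: pos_divide_le_eq)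
  then have mJ: "m \<le> J * k" by linarith
  obtain b where b: "span ((\<lambda>q. matrix_power A q *v b) ` {..<m}) = UNIV"
    using cyc by (auto simp: cyclic_def m_def)
  have "b \<noteq> 0"
  proof
    assume "b = 0"
    then have "span ((\<lambda>q. matrix_power A q *v b) ` {..<m}) \<subseteq> {0}"
      by (intro span_minimal) auto
    then have "axis undefined 1 \<in> {0::real^'n}" unfolding b by blast
    then show False by simp
  qed
  define c where "c l = matrix_power A (l * J) *v b" for l
  obtain X where X: "X \<in> admissible k" and ker: "\<And>v l. X *v v = 0 \<Longrightarrow> l < k \<Longrightarrow> c l \<bullet> v = 0"
    using admissible_of_vectors[of 0 k c] k \<open>b \<noteq> 0\<close> by (auto simp: c_def)
  have "unobservable J A X = {}"
  proof (rule ccontr)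
    assume "unobservable J A X \<noteq> {}"
    then obtain v where v: "norm v = 1" "\<And>q. q < J \<Longrightarrow> X *v (matrix_power (transpose A) q *v v) = 0"
      by (auto simp: unobservable_def)
    have "orthogonal v (matrix_power A i *v b)" if i: "i < m" for i
    proof -
      \<comment> \<open>Writing \<open>i = (i div J) * J + i mod J\<close> reaches
        \<open>A^i b\<close> from the starting vector \<open>c (i div J)\<close> by
        \<open>i mod J < J\<close> further steps.\<close>
      have l: "i div J < k" using i mJ by (simp add: less_mult_imp_div_less mult.commute)
      have q: "i mod J < J" using J by simp
      have "0 = c (i div J) \<bullet> (matrix_power (transpose A) (i mod J) *v v)"
        using ker[OF v(2)[OF q] l] by simp
      also have "\<dots> = (matrix_power A (i mod J) *v c (i div J)) \<bullet> v"
        by (simp add: inner_matrix_right transpose_matrix_power)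
      also have "matrix_power A (i mod J) *v c (i div J) = matrix_power A i *v b"
        by (simp add: c_def matrix_power_vector_add)
      finally show ?thesis by (simp add: orthogonal_def inner_commute)
    qed
    then have "orthogonal v w" if "w \<in> (\<lambda>q. matrix_power A q *v b) ` {..<m}" for w
      using that by auto
    then have "orthogonal v v"
      using orthogonal_to_span[of v "(\<lambda>q. matrix_power A q *v b) ` {..<m}" v] b by blast
    then show False using v(1) by (simp add: orthogonal_def)
  qed
  then have "s_k k A \<le> enat J"
    by (intro s_k_le[OF J X]) (simp add: admissible_krylov_iff[OF X])
  then show "s_k k A \<le> enat (nat \<lceil>real CARD('n) / real k\<rceil>)" by (simp add: J_def m_def)
  show "enat (nat \<lceil>real CARD('n) / real k\<rceil>) \<le> s_k k A"
    unfolding s_k_def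
  proof (rule Inf_greatest, clarify)
    fix j and X :: "real^'n^'n" assume X: "X \<in> admissible k" and full: "krylov j A X = UNIV"
    have "CARD('n) \<le> j * rank X" using dim_krylov_le[of j A X] full by simp
    also have "\<dots> \<le> j * k" using X by (intro mult_left_mono) (auto simp: admissible_def)
    finally have "real CARD('n) \<le> real (j * k)" by linarith
    then have "real CARD('n) / real k \<le> real j" using k by (simp add: pos_divide_le_eq)
    then show "enat (nat \<lceil>real CARD('n) / real k\<rceil>) \<le> enat j" by (simp add: nat_le_iff ceiling_le_iff)
  qed
qed

theorem proposition2p8:
  fixes A :: "real^'n^'n" and k :: nat
  assumes "k \<in> {1..CARD('n)}"
  shows "(s_k k A = \<infinity> \<longrightarrow> (\<forall>T>0. gamma_k k A T = 0)) \<and>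
    (\<forall>s. s_k k A = enat s \<longrightarrow>
      (\<exists>T0>0. \<exists>c C. 0 < c \<and> c \<le> C \<and>
         (\<forall>T\<in>{0<..T0}. c * T ^ (2 * s - 1) \<le> gamma_k k A T
                       \<and> gamma_k k A T \<le> C * T ^ (2 * s - 1))) \<and>
      (\<exists>ck>0.
         ((\<lambda>T. gamma_k k A T / (ck * T ^ (2 * s - 1))) \<longlongrightarrow> 1) (at_right 0) \<and>
         ((\<lambda>T. (gamma_k k A T / gamma_rel A T)
                / (real CARD('n) * ck * T ^ (2 * s - 2))) \<longlongrightarrow> 1) (at_right 0))) \<and>
    (cyclic A \<longrightarrow> s_k k A = enat (nat \<lceil>real CARD('n) / real k\<rceil>))"
proof (intro conjI impI allI)
  have k: "1 \<le> k" using assms by simp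
  show "gamma_k k A T = 0" if "s_k k A = \<infinity>" "0 < T" for T
    using gamma_k_zero[OF k that(1)] that(2) by simp
  show "s_k k A = enat (nat \<lceil>real CARD('n) / real k\<rceil>)" if "cyclic A"
    by (rule s_k_cyclic[OF k that])
  fix s assume s: "s_k k A = enat s"
  obtain d where d: "s = Suc d" using s_k_attained(1)[OF s] by (cases s) auto
  obtain X where X: "X \<in> admissible k" "krylov s A X = UNIV"
    using s_k_attained(2)[OF s] by blast
  have ne: "unobservable d A Y \<noteq> {}" if "Y \<in> admissible k" for Y
    by (rule unobservable_below_s_k[OF that]) (simp add: s d)
  define ck where "ck = leading_coeff k d A"
  have ck: "0 < ck"
    unfolding ck_def using X by (intro leading_coeff_pos[OF ne X(1)]) (simp_all add: admissible_krylov_iff d)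
  \<comment> \<open>Since \<open>s = Suc d\<close>, the truncated subtractions on naturals agree
    with the true ones.\<close>
  have exps: "2 * s - 1 = 2 * d + 1" "2 * s - 2 = 2 * d" by (simp_all add: d)
  have lim: "((\<lambda>T. gamma_k k A T / T ^ (2 * d + 1)) \<longlongrightarrow> ck) (at_right 0)"
    unfolding ck_def by (rule gamma_k_asymptotics[OF admissible_nonempty[OF k] ne])
  have pos: "eventually (\<lambda>T::real. 0 < T) (at_right 0)"
    by (simp add: eventually_at_right_less)
  have "eventually (\<lambda>T. ck / 2 < gamma_k k A T / T ^ (2 * d + 1)) (at_right 0)"
    "eventually (\<lambda>T. gamma_k k A T / T ^ (2 * d + 1) < 2 * ck) (at_right 0)"
    using ck by (intro order_tendstoD[OF lim]; simp)+
  then have "eventually (\<lambda>T. ck / 2 * T ^ (2 * d + 1) \<le> gamma_k k A T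
      \<and> gamma_k k A T \<le> 2 * ck * T ^ (2 * d + 1)) (at_right 0)"
    using pos
  proof eventually_elim
    case (elim T)
    then have "0 < T ^ (2 * d + 1)" by simp
    with elim show ?case
      by (metis less_imp_le pos_divide_less_eq pos_less_divide_eq)
  qed
  then obtain b where b: "0 < b" "\<And>T. 0 < T \<Longrightarrow> T < b \<Longrightarrow>
      ck / 2 * T ^ (2 * d + 1) \<le> gamma_k k A T \<and> gamma_k k A T \<le> 2 * ck * T ^ (2 * d + 1)"
    unfolding eventually_at_right_field by blast
  \<comment> \<open>The limit gives the bounds on the open interval up to \<open>b\<close>; halving
    \<open>b\<close> includes the endpoint \<open>T0\<close>.\<close>
  show "\<exists>T0>0. \<exists>c C. 0 < c \<and> c \<le> C \<and>
         (\<forall>T\<in>{0<..T0}. c * T ^ (2 * s - 1) \<le> gamma_k k A T \<and> gamma_k k A T \<le> C * T ^ (2 * s - 1))"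
    unfolding exps using b ck by (intro exI[of _ "b / 2"] exI[of _ "ck / 2"] exI[of _ "2 * ck"] conjI ballI) auto
  have lim1: "((\<lambda>T. gamma_k k A T / (ck * T ^ (2 * d + 1))) \<longlongrightarrow> 1) (at_right 0)"
    using tendsto_divide[OF lim tendsto_const[of ck]] ck by (simp add: field_simps)
  \<comment> \<open>Quotient of the two normalised limits; \<open>gamma_rel A T / T\<close> tending
    to \<open>1 / n\<close> supplies the factor \<open>n\<close> and cancels one power of
    \<open>T\<close>.\<close>
  have "((\<lambda>T. gamma_k k A T / (ck * T ^ (2 * d + 1)) / (real CARD('n) * (gamma_rel A T / T)))
      \<longlongrightarrow> 1 / (real CARD('n) * (1 / real CARD('n)))) (at_right 0)"
    by (intro tendsto_intros lim1 gamma_rel_asymptotics) simp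
  moreover have "eventually (\<lambda>T. gamma_k k A T / (ck * T ^ (2 * d + 1)) / (real CARD('n) * (gamma_rel A T / T))
      = (gamma_k k A T / gamma_rel A T) / (real CARD('n) * ck * T ^ (2 * d))) (at_right 0)"
    using pos by eventually_elim (simp add: field_simps)
  ultimately have lim2: "((\<lambda>T. (gamma_k k A T / gamma_rel A T) / (real CARD('n) * ck * T ^ (2 * d))) \<longlongrightarrow> 1) (at_right 0)"
    using tendsto_cong by fastforce
  show "\<exists>ck>0. ((\<lambda>T. gamma_k k A T / (ck * T ^ (2 * s - 1))) \<longlongrightarrow> 1) (at_right 0) \<and>
         ((\<lambda>T. (gamma_k k A T / gamma_rel A T) / (real CARD('n) * ck * T ^ (2 * s - 2))) \<longlongrightarrow> 1) (at_right 0)"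
    unfolding exps using ck lim1 lim2 by blast
qed

end
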